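(* The functor $\Pi_1\colon\mathsf{Graph}\to\mathsf{Gpd}$ is strict monoidal (from $(\mathsf{Graph},\square,I_0)$ to $(\mathsf{Gpd},\times,\ast)$). In particular, for any two graphs $X$ and $Y$, the functors $\Psi_{X,Y}\colon\Pi_1(X\square Y)\to\Pi_1X\times\Pi_1Y$ and $\Phi_{X,Y}\colon\Pi_1X\times\Pi_1Y\to\Pi_1(X\square Y)$ are inverse to each other.
   Context: Graphs are simple undirected graphs without loops; a graph map $f\colon X\to Y$ is a vertex function such that adjacent vertices go to equal or adjacent vertices; $\mathsf{Graph}$ is the resulting category and $\mathsf{Gpd}$ the category of small groupoids. $I_n$ ($n\in\mathbb{N}$) has vertices $0,\dots,n$ and edges $i\sim i+1$. The box product $X\square Y$ has vertex set $V(X)\times V(Y)$, with $(x,y)\sim(x',y')$ iff either $x\sim x'$ and $y=y'$, or $x=x'$ and $y\sim y'$; $I_0$ is its unit. A path $\gamma\colon x\rightsquigarrow x'$ of length $n$ is a graph map $\gamma\colon I_n\to X$ with $\gamma(0)=x,\gamma(n)=x'$; concatenation $\gamma\ast\sigma$ of $\gamma$ (length $m$) and $\sigma\colon x'\rightsquigarrow x''$ (length $n$) is the path of length $m+n$ equal to $\gamma(i)$ for $i\le m$ and $\sigma(i-m)$ for $i\ge m$; the reverse is $\overline{\gamma}(i)=\gamma(n-i)$. A shrinking map is a surjective order-preserving graph map $I_m\to I_n$. $P_nX(x,x')$ is the graph whose vertices are paths of length $n$ from $x$ to $x'$, with $\gamma\sim\sigma$ iff $\gamma\ne\sigma$ and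 $\gamma(i)=\sigma(i)$ or $\gamma(i)\sim\sigma(i)$ for all $i$. $P_{\mathbb{N}}X(x,x')$ is the quotient of $\coprod_{n\in\mathbb{N}}P_nX(x,x')$ by the equivalence relation generated by $\gamma\sim\gamma\circ s$ for shrinking maps $s$ (quotient graph: classes as vertices, distinct classes adjacent iff some representatives are). $\pi_0$ denotes the set of path-components. The fundamental groupoid $\Pi_1X$ has objects the vertices of $X$, morphisms $\Pi_1X(x,x')=\pi_0P_{\mathbb{N}}X(x,x')$, composition $[\sigma]\circ[\gamma]=[\gamma\ast\sigma]$, inverses $[\overline\gamma]$; a graph map $f$ induces $[\gamma]\mapsto[f\circ\gamma]$. $\Psi_{X,Y}$ has components $\Pi_1$ of the projections $X\square Y\to X$, $X\square Y\to Y$, i.e. $[\gamma]\mapsto([\pi_X\gamma],[\pi_Y\gamma])$. $\Phi_{X,Y}$ sends a morphism $([\sigma],[\tau])\colon(x,y)\to(x',y')$ to $[(\sigma\square y)\ast(x'\square\tau)]$, where $(\sigma\square y)(i)=(\sigma(i),y)$ and $(x'\square\tau)(j)=(x',\tau(j))$.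
   Formalization: "Strict monoidal" is read as: the structure functors Φ (inverse Ψ) and the unit functor are isomorphisms, Φ and Ψ the identity on objects, natural and coherent; literal equality Π₁(X□Y)=Π₁X×Π₁Y fails, since morphisms are path classes on one side and pairs on the other. *)

theory Defs
  imports Main "HOL-Library.FuncSet"
begin

section \<open>Graphs\<close>

record 'a pregraph =
  verts :: "'a set"
  adj :: "'a \<Rightarrow> 'a \<Rightarrow> bool"

definition simple_graph :: "'a pregraph \<Rightarrow> bool" where
  "simple_graph X \<longleftrightarrow>
     (\<forall>x y. adj X x y \<longrightarrow> x \<in> verts X \<and> y \<in> verts X \<and> x \<noteq> y \<and> adj X y x)"

text \<open>A graph map is an extensional function (value \<^term>\<open>undefined\<close> outside the vertex set), so
  that HOL equality of graph maps is equality of vertex functions. Identities, composites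
  and paths follow the same convention.\<close>

definition graph_map :: "'a pregraph \<Rightarrow> 'b pregraph \<Rightarrow> ('a \<Rightarrow> 'b) \<Rightarrow> bool" where
  "graph_map X Y f \<longleftrightarrow>
     f \<in> verts X \<rightarrow>\<^sub>E verts Y \<and>
     (\<forall>x y. adj X x y \<longrightarrow> f x = f y \<or> adj Y (f x) (f y))"

definition graph_id :: "'a pregraph \<Rightarrow> 'a \<Rightarrow> 'a" where
  "graph_id X = (\<lambda>x\<in>verts X. x)"

definition graph_comp :: "'a pregraph \<Rightarrow> ('b \<Rightarrow> 'c) \<Rightarrow> ('a \<Rightarrow> 'b) \<Rightarrow> 'a \<Rightarrow> 'c" where
  "graph_comp X g f = compose (verts X) g f"

definition interval :: "nat \<Rightarrow> nat pregraph" where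
  "interval n = \<lparr>verts = {..n},
     adj = (\<lambda>i j. i \<le> n \<and> j \<le> n \<and> (j = i + 1 \<or> i = j + 1))\<rparr>"

definition box :: "'a pregraph \<Rightarrow> 'b pregraph \<Rightarrow> ('a \<times> 'b) pregraph" (infixr \<open>\<box>\<close> 70) where
  "X \<box> Y = \<lparr>verts = verts X \<times> verts Y,
     adj = (\<lambda>(x, y) (x', y').
        (adj X x x' \<and> y = y' \<and> y \<in> verts Y) \<or> (x = x' \<and> x \<in> verts X \<and> adj Y y y'))\<rparr>"

definition box_map ::
  "'a pregraph \<Rightarrow> 'b pregraph \<Rightarrow> ('a \<Rightarrow> 'c) \<Rightarrow> ('b \<Rightarrow> 'd) \<Rightarrow> 'a \<times> 'b \<Rightarrow> 'c \<times> 'd" where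
  "box_map X Y f g = (\<lambda>(x, y)\<in>verts (X \<box> Y). (f x, g y))"

definition box_fst :: "'a pregraph \<Rightarrow> 'b pregraph \<Rightarrow> 'a \<times> 'b \<Rightarrow> 'a" where
  "box_fst X Y = restrict fst (verts (X \<box> Y))"

definition box_snd :: "'a pregraph \<Rightarrow> 'b pregraph \<Rightarrow> 'a \<times> 'b \<Rightarrow> 'b" where
  "box_snd X Y = restrict snd (verts (X \<box> Y))"

definition box_assoc ::
  "'a pregraph \<Rightarrow> 'b pregraph \<Rightarrow> 'c pregraph \<Rightarrow> ('a \<times> 'b) \<times> 'c \<Rightarrow> 'a \<times> ('b \<times> 'c)" where
  "box_assoc X Y Z = (\<lambda>((x, y), z)\<in>verts ((X \<box> Y) \<box> Z). (x, (y, z)))"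

definition box_lunit :: "'a pregraph \<Rightarrow> nat \<times> 'a \<Rightarrow> 'a" where
  "box_lunit X = restrict snd (verts (interval 0 \<box> X))"

definition box_runit :: "'a pregraph \<Rightarrow> 'a \<times> nat \<Rightarrow> 'a" where
  "box_runit X = restrict fst (verts (X \<box> interval 0))"


section \<open>Path graphs and path components\<close>

definition path_graph :: "nat \<Rightarrow> 'a pregraph \<Rightarrow> 'a \<Rightarrow> 'a \<Rightarrow> (nat \<Rightarrow> 'a) pregraph" where
  "path_graph n X x x' =
     (let P = {\<gamma>. graph_map (interval n) X \<gamma> \<and> \<gamma> 0 = x \<and> \<gamma> n = x'}
      in \<lparr>verts = P,
          adj = (\<lambda>\<gamma> \<sigma>. \<gamma> \<in> P \<and> \<sigma> \<in> P \<and> \<gamma> \<noteq> \<sigma> \<and>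
                   (\<forall>i\<le>n. \<gamma> i = \<sigma> i \<or> adj X (\<gamma> i) (\<sigma> i)))\<rparr>)"

definition connected_rel :: "'a pregraph \<Rightarrow> ('a \<times> 'a) set" where
  "connected_rel X = {(x, x'). \<exists>n. verts (path_graph n X x x') \<noteq> {}}"

definition pi0 :: "'a pregraph \<Rightarrow> 'a set set" where
  "pi0 X = verts X // connected_rel X"

definition generated_equiv :: "'a set \<Rightarrow> ('a \<Rightarrow> 'a \<Rightarrow> bool) \<Rightarrow> ('a \<times> 'a) set" where
  "generated_equiv A r = {(a, b). a \<in> A \<and> b \<in> A \<and> equivclp r a b}"

definition quotient_graph :: "'a pregraph \<Rightarrow> ('a \<times> 'a) set \<Rightarrow> 'a set pregraph" where
  "quotient_graph X R = \<lparr>verts = verts X // R,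
     adj = (\<lambda>A B. A \<in> verts X // R \<and> B \<in> verts X // R \<and> A \<noteq> B \<and>
              (\<exists>a\<in>A. \<exists>b\<in>B. adj X a b))\<rparr>"

definition shrinking :: "nat \<Rightarrow> nat \<Rightarrow> (nat \<Rightarrow> nat) \<Rightarrow> bool" where
  "shrinking m n s \<longleftrightarrow>
     graph_map (interval m) (interval n) s \<and>
     s ` verts (interval m) = verts (interval n) \<and> mono_on (verts (interval m)) s"

text \<open>A path of unspecified length is a pair of its length and its underlying graph map; these
  pairs are the vertices of the coproduct of the path graphs.\<close>

type_synonym 'a path = "nat \<times> (nat \<Rightarrow> 'a)"

definition coprod_path_graph :: "'a pregraph \<Rightarrow> 'a \<Rightarrow> 'a \<Rightarrow> 'a path pregraph" where
  "coprod_path_graph X x x' =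
     \<lparr>verts = (SIGMA n:UNIV. verts (path_graph n X x x')),
      adj = (\<lambda>(m, \<gamma>) (n, \<sigma>). m = n \<and> adj (path_graph n X x x') \<gamma> \<sigma>)\<rparr>"

abbreviation paths :: "'a pregraph \<Rightarrow> 'a \<Rightarrow> 'a \<Rightarrow> 'a path set" where
  "paths X x x' \<equiv> verts (coprod_path_graph X x x')"

definition shrink_step :: "'a pregraph \<Rightarrow> 'a \<Rightarrow> 'a \<Rightarrow> 'a path \<Rightarrow> 'a path \<Rightarrow> bool" where
  "shrink_step X x x' p q \<longleftrightarrow> p \<in> paths X x x' \<and>
     (\<exists>s. shrinking (fst q) (fst p) s \<and> snd q = graph_comp (interval (fst q)) (snd p) s)"

definition shrink_equiv :: "'a pregraph \<Rightarrow> 'a \<Rightarrow> 'a \<Rightarrow> ('a path \<times> 'a path) set" where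
  "shrink_equiv X x x' = generated_equiv (paths X x x') (shrink_step X x x')"

definition path_graph_N :: "'a pregraph \<Rightarrow> 'a \<Rightarrow> 'a \<Rightarrow> 'a path set pregraph" where
  "path_graph_N X x x' = quotient_graph (coprod_path_graph X x x') (shrink_equiv X x x')"

definition path_const :: "'a \<Rightarrow> 'a path" where
  "path_const x = (0, \<lambda>i\<in>verts (interval 0). x)"

definition path_concat :: "'a path \<Rightarrow> 'a path \<Rightarrow> 'a path" (infixr \<open>\<star>\<close> 65) where
  "p \<star> q = (fst p + fst q,
     \<lambda>i\<in>verts (interval (fst p + fst q)). if i \<le> fst p then snd p i else snd q (i - fst p))"

definition path_reverse :: "'a path \<Rightarrow> 'a path" where
  "path_reverse p = (fst p, \<lambda>i\<in>verts (interval (fst p)). snd p (fst p - i))"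

definition path_map :: "('a \<Rightarrow> 'b) \<Rightarrow> 'a path \<Rightarrow> 'b path" where
  "path_map f p = (fst p, graph_comp (interval (fst p)) f (snd p))"


section \<open>Groupoids and functors\<close>

text \<open>Groupoids are given by hom-families: \<open>Comp G x y z g f\<close> is the composite of
  \<open>f : x \<rightarrow> y\<close> with \<open>g : y \<rightarrow> z\<close>, and \<open>Inv G x y f\<close> is the inverse of \<open>f : x \<rightarrow> y\<close>.\<close>

record ('o, 'm) gpd =
  Ob :: "'o set"
  Hom :: "'o \<Rightarrow> 'o \<Rightarrow> 'm set"
  Ident :: "'o \<Rightarrow> 'm"
  Comp :: "'o \<Rightarrow> 'o \<Rightarrow> 'o \<Rightarrow> 'm \<Rightarrow> 'm \<Rightarrow> 'm"
  Inv :: "'o \<Rightarrow> 'o \<Rightarrow> 'm \<Rightarrow> 'm"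

definition groupoid :: "('o, 'm) gpd \<Rightarrow> bool" where
  "groupoid G \<longleftrightarrow>
     (\<forall>x\<in>Ob G. Ident G x \<in> Hom G x x) \<and>
     (\<forall>x\<in>Ob G. \<forall>y\<in>Ob G. \<forall>z\<in>Ob G. \<forall>f\<in>Hom G x y. \<forall>g\<in>Hom G y z.
        Comp G x y z g f \<in> Hom G x z) \<and>
     (\<forall>x\<in>Ob G. \<forall>y\<in>Ob G. \<forall>f\<in>Hom G x y.
        Comp G x x y f (Ident G x) = f \<and> Comp G x y y (Ident G y) f = f) \<and>
     (\<forall>w\<in>Ob G. \<forall>x\<in>Ob G. \<forall>y\<in>Ob G. \<forall>z\<in>Ob G.
        \<forall>f\<in>Hom G w x. \<forall>g\<in>Hom G x y. \<forall>h\<in>Hom G y z.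
        Comp G w x z (Comp G x y z h g) f = Comp G w y z h (Comp G w x y g f)) \<and>
     (\<forall>x\<in>Ob G. \<forall>y\<in>Ob G. \<forall>f\<in>Hom G x y.
        Inv G x y f \<in> Hom G y x \<and>
        Comp G x y x (Inv G x y f) f = Ident G x \<and>
        Comp G y x y f (Inv G x y f) = Ident G y)"

record ('o, 'm, 'p, 'n) fctr =
  fobj :: "'o \<Rightarrow> 'p"
  farr :: "'o \<Rightarrow> 'o \<Rightarrow> 'm \<Rightarrow> 'n"

definition is_functor :: "('o, 'm) gpd \<Rightarrow> ('p, 'n) gpd \<Rightarrow> ('o, 'm, 'p, 'n) fctr \<Rightarrow> bool" where
  "is_functor G H F \<longleftrightarrow>
     (\<forall>x\<in>Ob G. fobj F x \<in> Ob H) \<and>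
     (\<forall>x\<in>Ob G. \<forall>y\<in>Ob G. \<forall>f\<in>Hom G x y. farr F x y f \<in> Hom H (fobj F x) (fobj F y)) \<and>
     (\<forall>x\<in>Ob G. farr F x x (Ident G x) = Ident H (fobj F x)) \<and>
     (\<forall>x\<in>Ob G. \<forall>y\<in>Ob G. \<forall>z\<in>Ob G. \<forall>f\<in>Hom G x y. \<forall>g\<in>Hom G y z.
        farr F x z (Comp G x y z g f) =
        Comp H (fobj F x) (fobj F y) (fobj F z) (farr F y z g) (farr F x y f))"

text \<open>Object and arrow maps of functors are total HOL functions, so equality of functors with
  domain \<open>G\<close> is agreement on the objects and arrows of \<open>G\<close>.\<close>

definition functor_eq ::
  "('o, 'm) gpd \<Rightarrow> ('o, 'm, 'p, 'n) fctr \<Rightarrow> ('o, 'm, 'p, 'n) fctr \<Rightarrow> bool" where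
  "functor_eq G F F' \<longleftrightarrow>
     (\<forall>x\<in>Ob G. fobj F x = fobj F' x) \<and>
     (\<forall>x\<in>Ob G. \<forall>y\<in>Ob G. \<forall>f\<in>Hom G x y. farr F x y f = farr F' x y f)"

definition functor_id :: "('o, 'm, 'o, 'm) fctr" where
  "functor_id = \<lparr>fobj = (\<lambda>x. x), farr = (\<lambda>x y f. f)\<rparr>"

definition functor_comp ::
  "('p, 'n, 'q, 'k) fctr \<Rightarrow> ('o, 'm, 'p, 'n) fctr \<Rightarrow> ('o, 'm, 'q, 'k) fctr" (infixr \<open>\<circ>\<^sub>F\<close> 55) where
  "K \<circ>\<^sub>F F = \<lparr>fobj = (\<lambda>x. fobj K (fobj F x)),
     farr = (\<lambda>x y f. farr K (fobj F x) (fobj F y) (farr F x y f))\<rparr>"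

definition inverse_functors ::
  "('o, 'm) gpd \<Rightarrow> ('p, 'n) gpd \<Rightarrow> ('o, 'm, 'p, 'n) fctr \<Rightarrow> ('p, 'n, 'o, 'm) fctr \<Rightarrow> bool" where
  "inverse_functors G H F K \<longleftrightarrow>
     is_functor G H F \<and> is_functor H G K \<and>
     functor_eq G (K \<circ>\<^sub>F F) functor_id \<and> functor_eq H (F \<circ>\<^sub>F K) functor_id"

definition functor_iso :: "('o, 'm) gpd \<Rightarrow> ('p, 'n) gpd \<Rightarrow> ('o, 'm, 'p, 'n) fctr \<Rightarrow> bool" where
  "functor_iso G H F \<longleftrightarrow> (\<exists>K. inverse_functors G H F K)"

definition gpd_prod ::
  "('o, 'm) gpd \<Rightarrow> ('p, 'n) gpd \<Rightarrow> ('o \<times> 'p, 'm \<times> 'n) gpd" (infixr \<open>\<times>\<^sub>G\<close> 70) where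
  "G \<times>\<^sub>G H = \<lparr>Ob = Ob G \<times> Ob H,
     Hom = (\<lambda>(x, y) (x', y'). Hom G x x' \<times> Hom H y y'),
     Ident = (\<lambda>(x, y). (Ident G x, Ident H y)),
     Comp = (\<lambda>(x, y) (x', y') (x'', y'') (g, k) (f, h). (Comp G x x' x'' g f, Comp H y y' y'' k h)),
     Inv = (\<lambda>(x, y) (x', y') (f, h). (Inv G x x' f, Inv H y y' h))\<rparr>"

definition gpd_unit :: "(unit, unit) gpd" where
  "gpd_unit = \<lparr>Ob = {()}, Hom = (\<lambda>_ _. {()}), Ident = (\<lambda>_. ()),
     Comp = (\<lambda>_ _ _ _ _. ()), Inv = (\<lambda>_ _ _. ())\<rparr>"

definition functor_pair ::
  "('o, 'm, 'p, 'n) fctr \<Rightarrow> ('o, 'm, 'q, 'k) fctr \<Rightarrow> ('o, 'm, 'p \<times> 'q, 'n \<times> 'k) fctr" where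
  "functor_pair F K = \<lparr>fobj = (\<lambda>x. (fobj F x, fobj K x)),
     farr = (\<lambda>x y f. (farr F x y f, farr K x y f))\<rparr>"

definition functor_prod ::
  "('o, 'm, 'o2, 'm2) fctr \<Rightarrow> ('p, 'n, 'p2, 'n2) fctr \<Rightarrow>
   ('o \<times> 'p, 'm \<times> 'n, 'o2 \<times> 'p2, 'm2 \<times> 'n2) fctr" (infixr \<open>\<times>\<^sub>F\<close> 70) where
  "F \<times>\<^sub>F K = \<lparr>fobj = (\<lambda>(x, y). (fobj F x, fobj K y)),
     farr = (\<lambda>(x, y) (x', y') (f, h). (farr F x x' f, farr K y y' h))\<rparr>"

definition gpd_assoc ::
  "(('o \<times> 'p) \<times> 'q, ('m \<times> 'n) \<times> 'k, 'o \<times> ('p \<times> 'q), 'm \<times> ('n \<times> 'k)) fctr" where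
  "gpd_assoc = \<lparr>fobj = (\<lambda>((x, y), z). (x, (y, z))),
     farr = (\<lambda>_ _ ((f, g), h). (f, (g, h)))\<rparr>"

definition gpd_lunit :: "(unit \<times> 'o, unit \<times> 'm, 'o, 'm) fctr" where
  "gpd_lunit = \<lparr>fobj = snd, farr = (\<lambda>_ _. snd)\<rparr>"

definition gpd_runit :: "('o \<times> unit, 'm \<times> unit, 'o, 'm) fctr" where
  "gpd_runit = \<lparr>fobj = fst, farr = (\<lambda>_ _. fst)\<rparr>"


section \<open>The fundamental groupoid\<close>

text \<open>A morphism of the fundamental groupoid is a set of sets of paths: a path component of the
  quotient graph, whose vertices are themselves classes of paths. So the representatives of
  a morphism \<open>a\<close> are the elements of \<open>\<Union>a\<close>. Operations on morphisms are given on representatives;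
  the lemmas at the end show that they do not depend on the choice.\<close>

type_synonym 'a path_class = "'a path set set"

definition path_class :: "'a pregraph \<Rightarrow> 'a \<Rightarrow> 'a \<Rightarrow> 'a path \<Rightarrow> 'a path_class" where
  "path_class X x x' p = connected_rel (path_graph_N X x x') `` {shrink_equiv X x x' `` {p}}"

definition Pi1 :: "'a pregraph \<Rightarrow> ('a, 'a path_class) gpd" where
  "Pi1 X = \<lparr>Ob = verts X,
     Hom = (\<lambda>x x'. pi0 (path_graph_N X x x')),
     Ident = (\<lambda>x. path_class X x x (path_const x)),
     Comp = (\<lambda>x x' x'' b a.
        the_elem ((\<lambda>(\<gamma>, \<sigma>). path_class X x x'' (\<gamma> \<star> \<sigma>)) ` (\<Union>a \<times> \<Union>b))),
     Inv = (\<lambda>x x' a. the_elem ((\<lambda>\<gamma>. path_class X x' x (path_reverse \<gamma>)) ` \<Union>a))\<rparr>"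

definition Pi1_map ::
  "'b pregraph \<Rightarrow> ('a \<Rightarrow> 'b) \<Rightarrow> ('a, 'a path_class, 'b, 'b path_class) fctr" where
  "Pi1_map Y f = \<lparr>fobj = f,
     farr = (\<lambda>x x' a. the_elem ((\<lambda>\<gamma>. path_class Y (f x) (f x') (path_map f \<gamma>)) ` \<Union>a))\<rparr>"

definition Psi ::
  "'a pregraph \<Rightarrow> 'b pregraph \<Rightarrow>
   ('a \<times> 'b, ('a \<times> 'b) path_class, 'a \<times> 'b, 'a path_class \<times> 'b path_class) fctr" where
  "Psi X Y = functor_pair (Pi1_map X (box_fst X Y)) (Pi1_map Y (box_snd X Y))"

definition path_box_left :: "'a path \<Rightarrow> 'b \<Rightarrow> ('a \<times> 'b) path" where
  "path_box_left p y = (fst p, \<lambda>i\<in>verts (interval (fst p)). (snd p i, y))"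

definition path_box_right :: "'a \<Rightarrow> 'b path \<Rightarrow> ('a \<times> 'b) path" where
  "path_box_right x q = (fst q, \<lambda>j\<in>verts (interval (fst q)). (x, snd q j))"

definition Phi ::
  "'a pregraph \<Rightarrow> 'b pregraph \<Rightarrow>
   ('a \<times> 'b, 'a path_class \<times> 'b path_class, 'a \<times> 'b, ('a \<times> 'b) path_class) fctr" where
  "Phi X Y = \<lparr>fobj = (\<lambda>v. v),
     farr = (\<lambda>(x, y) (x', y') (a, b).
        the_elem ((\<lambda>(\<sigma>, \<tau>). path_class (X \<box> Y) (x, y) (x', y')
                      (path_box_left \<sigma> y \<star> path_box_right x' \<tau>)) ` (\<Union>a \<times> \<Union>b)))\<rparr>"

definition Pi1_unit :: "(unit, unit, nat, nat path_class) fctr" where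
  "Pi1_unit = \<lparr>fobj = (\<lambda>_. 0), farr = (\<lambda>_ _ _. Ident (Pi1 (interval 0)) 0)\<rparr>"


section \<open>Independence of representatives\<close>

lemma simple_graphD:
  assumes "simple_graph X" "adj X x y"
  shows "x \<in> verts X" "y \<in> verts X" "x \<noteq> y" "adj X y x"
  using assms unfolding simple_graph_def by blast+

lemma verts_interval [simp]: "verts (interval n) = {..n}"
  by (simp add: interval_def)

lemma simple_graph_interval: "simple_graph (interval n)"
  by (auto simp: simple_graph_def interval_def)

lemma simple_graph_box: "simple_graph X \<Longrightarrow> simple_graph Y \<Longrightarrow> simple_graph (X \<box> Y)"
  by (fastforce simp: simple_graph_def box_def)

lemma graph_map_interval_iff:
  assumes "simple_graph X"
  shows "graph_map (interval n) X g \<longleftrightarrow>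
     g \<in> extensional {..n} \<and> (\<forall>i\<le>n. g i \<in> verts X) \<and>
     (\<forall>i<n. g i = g (Suc i) \<or> adj X (g i) (g (Suc i)))" (is "?L \<longleftrightarrow> ?R")
proof
  assume ?L
  then show ?R by (auto simp: graph_map_def interval_def PiE_def)
next
  assume R: ?R
  have "g i = g j \<or> adj X (g i) (g j)" if "adj (interval n) i j" for i j
  proof -
    from that have "i \<le> n" "j \<le> n" "j = Suc i \<or> i = Suc j" by (auto simp: interval_def)
    then show ?thesis using R simple_graphD(4)[OF assms] by (metis Suc_le_lessD)
  qed
  then show ?L using R by (auto simp: graph_map_def PiE_def)
qed

lemma shrinking_iff:
  "shrinking m n s \<longleftrightarrow> s \<in> extensional {..m} \<and> s 0 = 0 \<and> s m = n \<and>
     (\<forall>i<m. s (Suc i) = s i \<or> s (Suc i) = Suc (s i))" (is "?L \<longleftrightarrow> ?R")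
proof
  assume L: ?L
  then have ext: "s \<in> extensional {..m}" and le: "\<forall>i\<le>m. s i \<le> n"
    and step: "\<forall>i<m. s i = s (Suc i) \<or> adj (interval n) (s i) (s (Suc i))"
    and img: "s ` {..m} = {..n}" and mono: "mono_on {..m} s"
    by (auto simp: shrinking_def graph_map_interval_iff simple_graph_interval)
  have m: "s i \<le> s j" if "i \<le> j" "j \<le> m" for i j
    using mono that by (auto simp: monotone_on_def)
  from img obtain i where "i \<le> m" "s i = 0" by (metis atMost_iff imageE zero_le)
  then have "s 0 = 0" using m[of 0 i] by simp
  moreover from img obtain j where "j \<le> m" "s j = n" by (metis atMost_iff imageE order_refl)
  then have "s m = n" using m[of j m] le by (simp add: le_antisym)
  moreover have "s (Suc i) = s i \<or> s (Suc i) = Suc (s i)" if "i < m" for i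
    using step that m[of i "Suc i"] by (auto simp: interval_def)
  ultimately show ?R using ext by blast
next
  assume R: ?R
  have m: "s i \<le> s j" if "i \<le> j" "j \<le> m" for i j
    using that
  proof (induction j rule: dec_induct)
    case (step k)
    then have "s i \<le> s k" "s (Suc k) = s k \<or> s (Suc k) = Suc (s k)"
      using R by auto
    then show ?case by auto
  qed simp
  have "\<exists>i\<le>m. s i = k" if "k \<le> s j" "j \<le> m" for k j
    using that
  proof (induction j)
    case 0 then show ?case using R by auto
  next
    case (Suc j)
    then have "s (Suc j) = s j \<or> s (Suc j) = Suc (s j)" using R by auto
    with Suc show ?case by (metis Suc_leD le_SucE)
  qed
  then have "{..n} \<subseteq> s ` {..m}" using R by fastforce
  moreover have "s i \<le> n" if "i \<le> m" for i using m[of i m] R that by simp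
  moreover have "s i = s (Suc i) \<or> adj (interval n) (s i) (s (Suc i))" if "i < m" for i
    using R that \<open>\<And>i. i \<le> m \<Longrightarrow> s i \<le> n\<close>[of i] \<open>\<And>i. i \<le> m \<Longrightarrow> s i \<le> n\<close>[of "Suc i"]
    by (auto simp: interval_def)
  ultimately show ?L
    using R m by (auto simp: shrinking_def graph_map_interval_iff simple_graph_interval
        monotone_on_def)
qed

lemma shrinking_le:
  assumes "shrinking m n s" "i \<le> m" shows "s i \<le> n"
  using assms by (auto simp: shrinking_def graph_map_def)

lemma paths_iff:
  assumes "simple_graph X"
  shows "p \<in> paths X x x' \<longleftrightarrow> snd p \<in> extensional {..fst p} \<and>
     (\<forall>i\<le>fst p. snd p i \<in> verts X) \<and>
     (\<forall>i<fst p. snd p i = snd p (Suc i) \<or> adj X (snd p i) (snd p (Suc i))) \<and>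
     snd p 0 = x \<and> snd p (fst p) = x'"
  by (cases p) (auto simp: coprod_path_graph_def path_graph_def Let_def graph_map_interval_iff[OF assms])

lemma adj_coprod_path_graph_iff:
  "adj (coprod_path_graph X x x') p q \<longleftrightarrow>
     p \<in> paths X x x' \<and> q \<in> paths X x x' \<and> p \<noteq> q \<and> fst p = fst q \<and>
     (\<forall>i\<le>fst p. snd p i = snd q i \<or> adj X (snd p i) (snd q i))"
  by (cases p; cases q) (auto simp: coprod_path_graph_def path_graph_def Let_def)

lemma shrink_step_paths:
  assumes "simple_graph X" "shrink_step X x x' p q"
  shows "q \<in> paths X x x'"
proof -
  obtain s where s: "shrinking (fst q) (fst p) s" "snd q = compose {..fst q} (snd p) s"
    and p: "p \<in> paths X x x'"
    using assms(2) by (auto simp: shrink_step_def graph_comp_def)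
  have "snd q i = snd q (Suc i) \<or> adj X (snd q i) (snd q (Suc i))" if "i < fst q" for i
  proof -
    have "s (Suc i) = s i \<or> s (Suc i) = Suc (s i)" using s(1) that by (auto simp: shrinking_iff)
    moreover have "s (Suc i) \<le> fst p" using shrinking_le[OF s(1)] that by simp
    ultimately show ?thesis using p that
      by (auto simp: paths_iff[OF assms(1)] s(2) compose_def Suc_le_eq)
  qed
  then show ?thesis using p s shrinking_le[OF s(1)]
    by (auto simp: paths_iff[OF assms(1)] compose_def shrinking_iff)
qed

lemma equiv_generated: "equiv A (generated_equiv A r)"
  by (rule equivI) (auto simp: generated_equiv_def refl_on_def sym_def trans_def
      intro: equivclp_sym equivclp_trans)

lemma equiv_shrink_equiv: "equiv (paths X x x') (shrink_equiv X x x')"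
  unfolding shrink_equiv_def by (rule equiv_generated)

lemma connected_rel_adj_closure:
  assumes "simple_graph X"
  shows "(a, b) \<in> connected_rel X \<longleftrightarrow> a \<in> verts X \<and> (adj X)\<^sup>*\<^sup>* a b"
proof
  assume "(a, b) \<in> connected_rel X"
  then obtain n g where g: "graph_map (interval n) X g" "g 0 = a" "g n = b"
    by (auto simp: connected_rel_def path_graph_def Let_def)
  have "(adj X)\<^sup>*\<^sup>* (g 0) (g k)" if "k \<le> n" for k
    using that
  proof (induction k)
    case (Suc k)
    then have "g k = g (Suc k) \<or> adj X (g k) (g (Suc k))"
      using g by (auto simp: graph_map_interval_iff[OF assms])
    then show ?case using Suc by (metis Suc_leD rtranclp.rtrancl_into_rtrancl)
  qed simp
  then show "a \<in> verts X \<and> (adj X)\<^sup>*\<^sup>* a b"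
    using g by (auto simp: graph_map_interval_iff[OF assms])
next
  assume R: "a \<in> verts X \<and> (adj X)\<^sup>*\<^sup>* a b"
  then have "(adj X)\<^sup>*\<^sup>* a b" by simp
  then have "\<exists>n g. graph_map (interval n) X g \<and> g 0 = a \<and> g n = b"
  proof (induction rule: rtranclp_induct)
    case base
    show ?case
      by (rule exI[of _ 0], rule exI[of _ "\<lambda>i\<in>{..0}. a"])
        (use R in \<open>auto simp: graph_map_interval_iff[OF assms] extensional_def\<close>)
  next
    case (step y z)
    then obtain n g where g: "graph_map (interval n) X g" "g 0 = a" "g n = y" by blast
    let ?h = "\<lambda>i\<in>{..Suc n}. if i \<le> n then g i else z"
    have "graph_map (interval (Suc n)) X ?h"
      using g step(2) simple_graphD(2)[OF assms step(2)]
      by (auto simp: graph_map_interval_iff[OF assms] less_Suc_eq)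
    moreover have "?h 0 = a" "?h (Suc n) = z" using g by auto
    ultimately show ?case by blast
  qed
  then show "(a, b) \<in> connected_rel X"
    by (auto simp: connected_rel_def path_graph_def Let_def)
qed

lemma equiv_connected_rel:
  assumes "simple_graph X"
  shows "equiv (verts X) (connected_rel X)"
proof (rule equivI)
  have v: "(adj X)\<^sup>*\<^sup>* a b \<Longrightarrow> a \<in> verts X \<Longrightarrow> b \<in> verts X" for a b
    by (induction rule: rtranclp_induct) (auto dest: simple_graphD(2)[OF assms])
  show "connected_rel X \<subseteq> verts X \<times> verts X"
    using v by (auto simp: connected_rel_adj_closure[OF assms])
  show "refl_on (verts X) (connected_rel X)"
    by (auto simp: refl_on_def connected_rel_adj_closure[OF assms])
  have "symp (adj X)" using simple_graphD(4)[OF assms] by (auto simp: symp_def)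
  then have "symp (adj X)\<^sup>*\<^sup>*" by (rule symp_rtranclp)
  then show "sym (connected_rel X)"
    using v by (auto simp: sym_def connected_rel_adj_closure[OF assms] dest: sympD)
  show "trans (connected_rel X)"
    by (auto simp: trans_def connected_rel_adj_closure[OF assms] intro: rtranclp_trans)
qed

lemma simple_graph_coprod:
  assumes "simple_graph X"
  shows "simple_graph (coprod_path_graph X x x')"
  unfolding simple_graph_def adj_coprod_path_graph_iff
  using simple_graphD(4)[OF assms] by metis

lemma simple_graph_path_graph_N:
  assumes "simple_graph X"
  shows "simple_graph (path_graph_N X x x')"
  using simple_graphD(4)[OF simple_graph_coprod[OF assms]]
  by (fastforce simp: simple_graph_def path_graph_N_def quotient_graph_def)

lemma path_class_eqI_shrink:
  assumes "simple_graph X" "shrink_step X x x' p q"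
  shows "path_class X x x' p = path_class X x x' q"
proof -
  have "(p, q) \<in> shrink_equiv X x x'"
    using assms shrink_step_paths[OF assms]
    by (auto simp: shrink_equiv_def generated_equiv_def r_into_equivclp)
      (auto simp: shrink_step_def)
  then show ?thesis
    unfolding path_class_def using equiv_class_eq[OF equiv_shrink_equiv] by metis
qed

lemma path_class_eqI_adj:
  assumes "simple_graph X" "adj (coprod_path_graph X x x') p q"
  shows "path_class X x x' p = path_class X x x' q"
proof -
  let ?E = "shrink_equiv X x x'" and ?N = "path_graph_N X x x'"
  have pq: "p \<in> paths X x x'" "q \<in> paths X x x'"
    using assms by (auto simp: adj_coprod_path_graph_iff)
  then have mem: "p \<in> ?E `` {p}" "q \<in> ?E `` {q}"
    using equiv_class_self[OF equiv_shrink_equiv] by metis+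
  have "?E `` {p} = ?E `` {q} \<or> adj ?N (?E `` {p}) (?E `` {q})"
    using pq mem assms(2) by (auto simp: path_graph_N_def quotient_graph_def quotientI)
  moreover have "?E `` {p} \<in> verts ?N"
    using pq by (auto simp: path_graph_N_def quotient_graph_def quotientI)
  ultimately have "(?E `` {p}, ?E `` {q}) \<in> connected_rel ?N"
    using connected_rel_adj_closure[OF simple_graph_path_graph_N[OF assms(1)]] by auto
  then show ?thesis unfolding path_class_def
    by (rule equiv_class_eq[OF equiv_connected_rel[OF simple_graph_path_graph_N[OF assms(1)]]])
qed

lemma path_class_lift:
  assumes X: "simple_graph X"
    and shr: "\<And>p q. shrink_step X x x' p q \<Longrightarrow> F p = F q"
    and adj: "\<And>p q. adj (coprod_path_graph X x x') p q \<Longrightarrow> F p = F q"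
    and p: "p \<in> paths X x x'" and q: "q \<in> paths X x x'"
    and eq: "path_class X x x' p = path_class X x x' q"
  shows "F p = F q"
proof -
  let ?E = "shrink_equiv X x x'" and ?N = "path_graph_N X x x'"
  have E: "F a = F b" if "(a, b) \<in> ?E" for a b
  proof -
    have "equivclp (shrink_step X x x') a b"
      using that by (auto simp: shrink_equiv_def generated_equiv_def)
    then show ?thesis
      by (induction rule: equivclp_induct) (auto dest: shr)
  qed
  have Q: "F a = F b" if "A \<in> paths X x x' // ?E" "a \<in> A" "b \<in> A" for A a b
    by (rule E, rule in_quotient_imp_in_rel[OF equiv_shrink_equiv that(1)]) (use that in simp)
  have conn: "\<forall>a\<in>A. \<forall>b\<in>B. F a = F b" if "(adj ?N)\<^sup>*\<^sup>* A B" "A \<in> verts ?N" for A B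
    using that(1)
  proof (induction rule: rtranclp_induct)
    case base
    have "A \<in> paths X x x' // ?E"
      using that(2) by (simp add: path_graph_N_def quotient_graph_def)
    then show ?case by (intro ballI) (rule Q)
  next
    case (step B C)
    from step(2) obtain b c where b: "b \<in> B" and c: "c \<in> C"
      and bc: "adj (coprod_path_graph X x x') b c" and C: "C \<in> paths X x x' // ?E"
      by (auto simp: path_graph_N_def quotient_graph_def)
    show ?case
    proof (intro ballI)
      fix a c' assume a: "a \<in> A" and c': "c' \<in> C"
      have "F a = F b" using step(3) a b by blast
      also have "F b = F c" by (rule adj[OF bc])
      also have "F c = F c'" by (rule Q[OF C c c'])
      finally show "F a = F c'" .
    qed
  qed
  have vp: "?E `` {p} \<in> verts ?N" and vq: "?E `` {q} \<in> verts ?N"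
    using p q by (simp_all add: path_graph_N_def quotient_graph_def quotientI)
  have "(?E `` {p}, ?E `` {q}) \<in> connected_rel ?N"
    using eq unfolding path_class_def
    by (rule eq_equiv_class[OF _ equiv_connected_rel[OF simple_graph_path_graph_N[OF X]] vq])
  then have pq: "(adj ?N)\<^sup>*\<^sup>* (?E `` {p}) (?E `` {q})"
    using connected_rel_adj_closure[OF simple_graph_path_graph_N[OF X]] by blast
  have "p \<in> ?E `` {p}" "q \<in> ?E `` {q}"
    by (rule equiv_class_self[OF equiv_shrink_equiv p])
      (rule equiv_class_self[OF equiv_shrink_equiv q])
  then show ?thesis using conn[OF pq vp] by blast
qed

lemma Hom_Pi1:
  "Hom (Pi1 X) x x' = path_class X x x' ` paths X x x'"
proof -
  have "verts (path_graph_N X x x') = (\<lambda>p. shrink_equiv X x x' `` {p}) ` paths X x x'"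
    by (simp add: path_graph_N_def quotient_graph_def quotient_def UNION_singleton_eq_range)
  then show ?thesis
    by (simp add: Pi1_def pi0_def quotient_def UNION_singleton_eq_range image_image path_class_def)
qed

lemma Union_path_class:
  assumes "simple_graph X" "p \<in> paths X x x'"
  shows "\<Union> (path_class X x x' p) = {q \<in> paths X x x'. path_class X x x' q = path_class X x x' p}"
proof -
  let ?E = "shrink_equiv X x x'" and ?N = "path_graph_N X x x'"
  note eN = equiv_connected_rel[OF simple_graph_path_graph_N[OF assms(1)], of x x']
  have vN: "verts ?N = paths X x x' // ?E" by (simp add: path_graph_N_def quotient_graph_def)
  show ?thesis
  proof (intro set_eqI iffI)
    fix q assume "q \<in> \<Union> (path_class X x x' p)"
    then obtain A where A: "q \<in> A" "(?E `` {p}, A) \<in> connected_rel ?N"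
      by (auto simp: path_class_def)
    have "connected_rel ?N \<subseteq> verts ?N \<times> verts ?N" using eN unfolding equiv_def by (rule conjunct1)
    with A(2) have "A \<in> paths X x x' // ?E" unfolding vN by blast
    then obtain r where "r \<in> paths X x x'" and r: "A = ?E `` {r}" by (rule quotientE)
    then have rq: "(r, q) \<in> ?E" using A(1) by simp
    then have q: "q \<in> paths X x x'" by (simp add: shrink_equiv_def generated_equiv_def)
    have "A = ?E `` {q}" using r equiv_class_eq[OF equiv_shrink_equiv rq] by simp
    with q show "q \<in> {q \<in> paths X x x'. path_class X x x' q = path_class X x x' p}"
      using equiv_class_eq[OF eN A(2)] by (simp add: path_class_def)
  next
    fix q assume "q \<in> {q \<in> paths X x x'. path_class X x x' q = path_class X x x' p}"
    then have q: "q \<in> paths X x x'" "path_class X x x' q = path_class X x x' p" by auto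
    then have "?E `` {q} \<in> verts ?N" by (simp add: vN quotientI)
    then have "?E `` {q} \<in> path_class X x x' q"
      unfolding path_class_def by (rule equiv_class_self[OF eN])
    then have "?E `` {q} \<in> path_class X x x' p" using q(2) by simp
    then show "q \<in> \<Union> (path_class X x x' p)"
      using equiv_class_self[OF equiv_shrink_equiv q(1)] by blast
  qed
qed

lemma the_elem_image_const:
  assumes "a \<in> A" "\<And>b. b \<in> A \<Longrightarrow> h b = h a"
  shows "the_elem (h ` A) = h a"
proof -
  have "h ` A \<subseteq> {h a}"
  proof (rule image_subsetI)
    fix b assume "b \<in> A"
    then have "h b = h a" by (rule assms(2))
    then show "h b \<in> {h a}" by simp
  qed
  moreover have "{h a} \<subseteq> h ` A" using assms(1) by blast
  ultimately have "h ` A = {h a}" by (rule subset_antisym)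
  then show ?thesis by simp
qed

lemma path_concat_in_paths:
  assumes X: "simple_graph X" and p: "p \<in> paths X x y" and q: "q \<in> paths X y z"
  shows "p \<star> q \<in> paths X x z"
proof -
  have pv: "\<And>i. i \<le> fst p \<Longrightarrow> snd p i \<in> verts X"
    and ps: "\<And>i. i < fst p \<Longrightarrow> snd p i = snd p (Suc i) \<or> adj X (snd p i) (snd p (Suc i))"
    and p0: "snd p 0 = x" and p1: "snd p (fst p) = y"
    using p unfolding paths_iff[OF X] by blast+
  have qv: "\<And>i. i \<le> fst q \<Longrightarrow> snd q i \<in> verts X"
    and qs: "\<And>i. i < fst q \<Longrightarrow> snd q i = snd q (Suc i) \<or> adj X (snd q i) (snd q (Suc i))"
    and q0: "snd q 0 = y" and q1: "snd q (fst q) = z"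
    using q unfolding paths_iff[OF X] by blast+
  have len: "fst (p \<star> q) = fst p + fst q" by (simp add: path_concat_def)
  have l: "snd (p \<star> q) i = snd p i" if "i \<le> fst p" for i
    using that by (simp add: path_concat_def)
  have r: "snd (p \<star> q) (fst p + k) = snd q k" if "k \<le> fst q" for k
    using that p1 q0 by (simp add: path_concat_def)
  have "snd (p \<star> q) i = snd (p \<star> q) (Suc i) \<or> adj X (snd (p \<star> q) i) (snd (p \<star> q) (Suc i))"
    if "i < fst p + fst q" for i
  proof (cases "i < fst p")
    case True
    then show ?thesis using ps[OF True] l[of i] l[of "Suc i"] by simp
  next
    case False
    then obtain k where k: "i = fst p + k" by (metis le_Suc_ex not_less)
    then have "k < fst q" using that by simp
    then show ?thesis using qs[of k] r[of k] r[of "Suc k"] k by simp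
  qed
  moreover have "snd (p \<star> q) i \<in> verts X" if "i \<le> fst p + fst q" for i
    using that pv qv by (simp add: path_concat_def)
  moreover have "snd (p \<star> q) (fst p + fst q) = z" using r[of "fst q"] q1 by simp
  moreover have "snd (p \<star> q) 0 = x" using l[of 0] p0 by simp
  moreover have "snd (p \<star> q) \<in> extensional {..fst p + fst q}" by (simp add: path_concat_def)
  ultimately show ?thesis unfolding paths_iff[OF X] len by blast
qed

lemma path_class_eqI_close:
  assumes X: "simple_graph X" and p: "p \<in> paths X x y" and q: "q \<in> paths X x y"
    and len: "fst p = fst q"
    and close: "\<And>i. i \<le> fst p \<Longrightarrow> snd p i = snd q i \<or> adj X (snd p i) (snd q i)"
  shows "path_class X x y p = path_class X x y q"
proof (cases "p = q")
  case False
  then have "adj (coprod_path_graph X x y) p q"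
    unfolding adj_coprod_path_graph_iff using p q len close by blast
  then show ?thesis by (rule path_class_eqI_adj[OF X])
qed simp

lemma path_class_eqI_reparam:
  assumes X: "simple_graph X" and p: "p \<in> paths X x y" and q: "q \<in> paths X x y"
    and s: "shrinking (fst q) (fst p) s"
    and eq: "\<And>i. i \<le> fst q \<Longrightarrow> snd q i = snd p (s i)"
  shows "path_class X x y p = path_class X x y q"
proof -
  have "snd q \<in> extensional {..fst q}" using q unfolding paths_iff[OF X] by blast
  then have "snd q = graph_comp (interval (fst q)) (snd p) s"
    unfolding graph_comp_def verts_interval
    by (rule extensionalityI[where A = "{..fst q}"]) (simp_all add: eq compose_def)
  then have "shrink_step X x y p q" using p s unfolding shrink_step_def by blast
  then show ?thesis by (rule path_class_eqI_shrink[OF X])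
qed

lemma shrink_stepE:
  assumes "simple_graph X" "shrink_step X x y p q"
  obtains s where "p \<in> paths X x y" "q \<in> paths X x y" "shrinking (fst q) (fst p) s"
    "\<And>i. i \<le> fst q \<Longrightarrow> snd q i = snd p (s i)" "\<And>i. i \<le> fst q \<Longrightarrow> s i \<le> fst p"
proof -
  obtain s where s: "shrinking (fst q) (fst p) s" "snd q = compose {..fst q} (snd p) s"
    and p: "p \<in> paths X x y"
    using assms(2) unfolding shrink_step_def graph_comp_def verts_interval by blast
  have "\<And>i. i \<le> fst q \<Longrightarrow> snd q i = snd p (s i)" unfolding s(2) by (simp add: compose_def)
  then show thesis using that[OF p shrink_step_paths[OF assms] s(1)] shrinking_le[OF s(1)] by blast
qed

lemma path_endpoint_eqs:
  assumes "simple_graph X" "p \<in> paths X x y"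
  shows "snd p 0 = x" "snd p (fst p) = y"
  using assms unfolding paths_iff[OF assms(1)] by blast+

lemma fst_path_concat: "fst (p \<star> q) = fst p + fst q"
  by (simp add: path_concat_def)

lemma path_concat_left: "i \<le> fst p \<Longrightarrow> snd (p \<star> q) i = snd p i"
  by (simp add: path_concat_def)

lemma path_concat_right:
  assumes "simple_graph X" "p \<in> paths X x y" "q \<in> paths X y z" "k \<le> fst q"
  shows "snd (p \<star> q) (fst p + k) = snd q k"
  using assms(4) path_endpoint_eqs[OF assms(1,2)] path_endpoint_eqs[OF assms(1,3)]
  by (simp add: path_concat_def)

lemma le_add_cases:
  fixes i m n :: nat
  assumes "i \<le> m + n"
  obtains "i \<le> m" | k where "i = m + k" "0 < k" "k \<le> n"
  by (cases "i \<le> m") (use assms in \<open>auto simp: not_le dest!: less_imp_Suc_add\<close>)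

lemma path_class_concat_cong:
  assumes X: "simple_graph X"
    and p: "p \<in> paths X x y" "p' \<in> paths X x y" "path_class X x y p = path_class X x y p'"
    and q: "q \<in> paths X y z" "q' \<in> paths X y z" "path_class X y z q = path_class X y z q'"
  shows "path_class X x z (p \<star> q) = path_class X x z (p' \<star> q')"
proof -
  have "path_class X x z (p \<star> q) = path_class X x z (p' \<star> q)"
  proof (rule path_class_lift[OF X _ _ p, where F = "\<lambda>p. path_class X x z (p \<star> q)"])
    fix a b assume "shrink_step X x y a b"
    then obtain s where a: "a \<in> paths X x y" and b: "b \<in> paths X x y"
      and s: "shrinking (fst b) (fst a) s"
      and sb: "\<And>i. i \<le> fst b \<Longrightarrow> snd b i = snd a (s i)"
      and sl: "\<And>i. i \<le> fst b \<Longrightarrow> s i \<le> fst a"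
      by (rule shrink_stepE[OF X]) blast
    define t where "t = (\<lambda>i\<in>{..fst b + fst q}. if i \<le> fst b then s i else fst a + (i - fst b))"
    have t1: "t i = s i" if "i \<le> fst b" for i using that by (simp add: t_def)
    have sm: "s (fst b) = fst a" using s unfolding shrinking_iff by blast
    have t2: "t (fst b + k) = fst a + k" if "k \<le> fst q" for k
      using that sm by (simp add: t_def)
    have "t (Suc i) = t i \<or> t (Suc i) = Suc (t i)" if "i < fst b + fst q" for i
    proof (cases "i < fst b")
      case True
      then have "s (Suc i) = s i \<or> s (Suc i) = Suc (s i)" using s unfolding shrinking_iff by blast
      then show ?thesis using True t1[of i] t1[of "Suc i"] by simp
    next
      case False
      then obtain k where "i = fst b + k" by (metis le_Suc_ex not_less)
      then show ?thesis using t2[of k] t2[of "Suc k"] that by simp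
    qed
    moreover have "t \<in> extensional {..fst b + fst q}" by (simp add: t_def)
    moreover have "t 0 = 0" using t1[of 0] s unfolding shrinking_iff by simp
    ultimately have t: "shrinking (fst (b \<star> q)) (fst (a \<star> q)) t"
      unfolding shrinking_iff fst_path_concat using t2[of "fst q"] by blast
    show "path_class X x z (a \<star> q) = path_class X x z (b \<star> q)"
    proof (rule path_class_eqI_reparam[OF X path_concat_in_paths[OF X a q(1)]
          path_concat_in_paths[OF X b q(1)] t])
      fix i assume "i \<le> fst (b \<star> q)"
      then have "i \<le> fst b + fst q" by (simp only: fst_path_concat)
      then show "snd (b \<star> q) i = snd (a \<star> q) (t i)"
      proof (cases rule: le_add_cases)
        case 1
        then show ?thesis using t1[of i] sl[of i] sb[of i] by (simp add: path_concat_left)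
      next
        case (2 k)
        then show ?thesis
          using t2[of k] path_concat_right[OF X a q(1), of k] path_concat_right[OF X b q(1), of k]
          by simp
      qed
    qed
  next
    fix a b assume "adj (coprod_path_graph X x y) a b"
    then have a: "a \<in> paths X x y" and b: "b \<in> paths X x y" and len: "fst a = fst b"
      and cl: "\<And>i. i \<le> fst a \<Longrightarrow> snd a i = snd b i \<or> adj X (snd a i) (snd b i)"
      unfolding adj_coprod_path_graph_iff by blast+
    show "path_class X x z (a \<star> q) = path_class X x z (b \<star> q)"
    proof (rule path_class_eqI_close[OF X path_concat_in_paths[OF X a q(1)]
          path_concat_in_paths[OF X b q(1)]])
      show "fst (a \<star> q) = fst (b \<star> q)" by (simp add: fst_path_concat len)
      fix i assume "i \<le> fst (a \<star> q)"
      then have "i \<le> fst a + fst q" by (simp only: fst_path_concat)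
      then show "snd (a \<star> q) i = snd (b \<star> q) i \<or> adj X (snd (a \<star> q) i) (snd (b \<star> q) i)"
      proof (cases rule: le_add_cases)
        case 1
        then show ?thesis using cl[of i] len by (simp add: path_concat_left)
      next
        case (2 k)
        then show ?thesis using len
            path_concat_right[OF X a q(1), of k] path_concat_right[OF X b q(1), of k] by simp
      qed
    qed
  qed
  also have "\<dots> = path_class X x z (p' \<star> q')"
  proof (rule path_class_lift[OF X _ _ q, where F = "\<lambda>q. path_class X x z (p' \<star> q)"])
    fix a b assume "shrink_step X y z a b"
    then obtain s where a: "a \<in> paths X y z" and b: "b \<in> paths X y z"
      and s: "shrinking (fst b) (fst a) s"
      and sb: "\<And>i. i \<le> fst b \<Longrightarrow> snd b i = snd a (s i)"
      and sl: "\<And>i. i \<le> fst b \<Longrightarrow> s i \<le> fst a"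
      by (rule shrink_stepE[OF X]) blast
    define t where "t = (\<lambda>i\<in>{..fst p' + fst b}. if i \<le> fst p' then i else fst p' + s (i - fst p'))"
    have t1: "t i = i" if "i \<le> fst p'" for i using that by (simp add: t_def)
    have s0: "s 0 = 0" and sm: "s (fst b) = fst a" using s unfolding shrinking_iff by blast+
    have t2: "t (fst p' + k) = fst p' + s k" if "k \<le> fst b" for k
      using that s0 by (simp add: t_def)
    have "t (Suc i) = t i \<or> t (Suc i) = Suc (t i)" if "i < fst p' + fst b" for i
    proof (cases "i < fst p'")
      case True
      then show ?thesis using t1[of i] t1[of "Suc i"] by simp
    next
      case False
      then obtain k where k: "i = fst p' + k" by (metis le_Suc_ex not_less)
      then have "k < fst b" using that by simp
      then have "s (Suc k) = s k \<or> s (Suc k) = Suc (s k)" using s unfolding shrinking_iff by blast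
      then show ?thesis using t2[of k] t2[of "Suc k"] \<open>k < fst b\<close> k by auto
    qed
    moreover have "t \<in> extensional {..fst p' + fst b}" by (simp add: t_def)
    moreover have "t 0 = 0" using t1[of 0] by simp
    moreover have "t (fst p' + fst b) = fst p' + fst a" using t2[of "fst b"] sm by simp
    ultimately have t: "shrinking (fst (p' \<star> b)) (fst (p' \<star> a)) t"
      unfolding shrinking_iff fst_path_concat by blast
    show "path_class X x z (p' \<star> a) = path_class X x z (p' \<star> b)"
    proof (rule path_class_eqI_reparam[OF X path_concat_in_paths[OF X p(2) a]
          path_concat_in_paths[OF X p(2) b] t])
      fix i assume "i \<le> fst (p' \<star> b)"
      then have "i \<le> fst p' + fst b" by (simp only: fst_path_concat)
      then show "snd (p' \<star> b) i = snd (p' \<star> a) (t i)"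
      proof (cases rule: le_add_cases)
        case 1
        then show ?thesis using t1[of i] by (simp add: path_concat_left)
      next
        case (2 k)
        then show ?thesis using t2[of k] sl[of k] sb[of k]
            path_concat_right[OF X p(2) a, of "s k"] path_concat_right[OF X p(2) b, of k]
          by simp
      qed
    qed
  next
    fix a b assume "adj (coprod_path_graph X y z) a b"
    then have a: "a \<in> paths X y z" and b: "b \<in> paths X y z" and len: "fst a = fst b"
      and cl: "\<And>i. i \<le> fst a \<Longrightarrow> snd a i = snd b i \<or> adj X (snd a i) (snd b i)"
      unfolding adj_coprod_path_graph_iff by blast+
    show "path_class X x z (p' \<star> a) = path_class X x z (p' \<star> b)"
    proof (rule path_class_eqI_close[OF X path_concat_in_paths[OF X p(2) a]
          path_concat_in_paths[OF X p(2) b]])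
      show "fst (p' \<star> a) = fst (p' \<star> b)" by (simp add: fst_path_concat len)
      fix i assume "i \<le> fst (p' \<star> a)"
      then have "i \<le> fst p' + fst a" by (simp only: fst_path_concat)
      then show "snd (p' \<star> a) i = snd (p' \<star> b) i \<or> adj X (snd (p' \<star> a) i) (snd (p' \<star> b) i)"
      proof (cases rule: le_add_cases)
        case 1
        then show ?thesis by (simp add: path_concat_left)
      next
        case (2 k)
        then show ?thesis using cl[of k] len
            path_concat_right[OF X p(2) a, of k] path_concat_right[OF X p(2) b, of k] by simp
      qed
    qed
  qed
  finally show ?thesis .
qed

lemma path_reverse_in_paths:
  assumes X: "simple_graph X" and p: "p \<in> paths X x y"
  shows "path_reverse p \<in> paths X y x"
proof -
  have pv: "\<And>i. i \<le> fst p \<Longrightarrow> snd p i \<in> verts X"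
    and ps: "\<And>i. i < fst p \<Longrightarrow> snd p i = snd p (Suc i) \<or> adj X (snd p i) (snd p (Suc i))"
    and p0: "snd p 0 = x" and p1: "snd p (fst p) = y"
    using p unfolding paths_iff[OF X] by blast+
  have len: "fst (path_reverse p) = fst p" by (simp add: path_reverse_def)
  have r: "snd (path_reverse p) i = snd p (fst p - i)" if "i \<le> fst p" for i
    using that by (simp add: path_reverse_def)
  have "snd (path_reverse p) i = snd (path_reverse p) (Suc i) \<or>
      adj X (snd (path_reverse p) i) (snd (path_reverse p) (Suc i))"
    if "i < fst p" for i
  proof -
    define k where "k = fst p - Suc i"
    have k: "fst p - i = Suc k" "k < fst p" using that by (auto simp: k_def)
    have "snd p (Suc k) = snd p k \<or> adj X (snd p (Suc k)) (snd p k)"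
      using ps[OF k(2)] simple_graphD(4)[OF X] by metis
    moreover have "snd (path_reverse p) i = snd p (Suc k)" "snd (path_reverse p) (Suc i) = snd p k"
      using that r[of i] r[of "Suc i"] k(1) by (simp_all add: k_def)
    ultimately show ?thesis by simp
  qed
  moreover have "snd (path_reverse p) i \<in> verts X" if "i \<le> fst p" for i
    using r[OF that] pv[of "fst p - i"] by simp
  moreover have "snd (path_reverse p) 0 = y" "snd (path_reverse p) (fst p) = x"
    using r[of 0] r[of "fst p"] p0 p1 by simp_all
  moreover have "snd (path_reverse p) \<in> extensional {..fst p}" by (simp add: path_reverse_def)
  ultimately show ?thesis unfolding paths_iff[OF X] len by blast
qed

lemma path_class_reverse_cong:
  assumes X: "simple_graph X"
    and p: "p \<in> paths X x y" "p' \<in> paths X x y" "path_class X x y p = path_class X x y p'"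
  shows "path_class X y x (path_reverse p) = path_class X y x (path_reverse p')"
proof (rule path_class_lift[OF X _ _ p, where F = "\<lambda>p. path_class X y x (path_reverse p)"])
  have len: "fst (path_reverse r) = fst r" for r :: "'a path" by (simp add: path_reverse_def)
  have rev: "snd (path_reverse r) i = snd r (fst r - i)" if "i \<le> fst r" for r :: "'a path" and i
    using that by (simp add: path_reverse_def)
  {
    fix a b assume "shrink_step X x y a b"
    then obtain s where a: "a \<in> paths X x y" and b: "b \<in> paths X x y"
      and s: "shrinking (fst b) (fst a) s"
      and sb: "\<And>i. i \<le> fst b \<Longrightarrow> snd b i = snd a (s i)"
      and sl: "\<And>i. i \<le> fst b \<Longrightarrow> s i \<le> fst a"
      by (rule shrink_stepE[OF X]) blast
    define t where "t = (\<lambda>i\<in>{..fst b}. fst a - s (fst b - i))"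
    have t: "t i = fst a - s (fst b - i)" if "i \<le> fst b" for i using that by (simp add: t_def)
    have s0: "s 0 = 0" and sm: "s (fst b) = fst a" using s unfolding shrinking_iff by blast+
    have "t (Suc i) = t i \<or> t (Suc i) = Suc (t i)" if "i < fst b" for i
    proof -
      define k where "k = fst b - Suc i"
      have k: "fst b - i = Suc k" "k < fst b" using that by (auto simp: k_def)
      have "s (Suc k) = s k \<or> s (Suc k) = Suc (s k)" using s k(2) unfolding shrinking_iff by blast
      moreover have "t i = fst a - s (Suc k)" "t (Suc i) = fst a - s k"
        using t[of i] t[of "Suc i"] that k(1) by (simp_all add: k_def)
      ultimately show ?thesis using sl[of "Suc k"] k(2) by auto
    qed
    moreover have "t \<in> extensional {..fst b}" by (simp add: t_def)
    moreover have "t 0 = 0" "t (fst b) = fst a" using t[of 0] t[of "fst b"] s0 sm by simp_all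
    ultimately have sh: "shrinking (fst (path_reverse b)) (fst (path_reverse a)) t"
      unfolding shrinking_iff len by blast
    show "path_class X y x (path_reverse a) = path_class X y x (path_reverse b)"
    proof (rule path_class_eqI_reparam[OF X path_reverse_in_paths[OF X a]
          path_reverse_in_paths[OF X b] sh])
      fix i assume "i \<le> fst (path_reverse b)"
      then have i: "i \<le> fst b" by (simp only: len)
      then have "snd (path_reverse b) i = snd a (s (fst b - i))"
        using rev[of i b] sb[of "fst b - i"] by simp
      moreover have "snd (path_reverse a) (t i) = snd a (s (fst b - i))"
        using rev[of "t i" a] t[OF i] sl[of "fst b - i"] by simp
      ultimately show "snd (path_reverse b) i = snd (path_reverse a) (t i)" by simp
    qed
  next
    fix a b assume "adj (coprod_path_graph X x y) a b"
    then have a: "a \<in> paths X x y" and b: "b \<in> paths X x y" and ab: "fst a = fst b"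
      and cl: "\<And>i. i \<le> fst a \<Longrightarrow> snd a i = snd b i \<or> adj X (snd a i) (snd b i)"
      unfolding adj_coprod_path_graph_iff by blast+
    show "path_class X y x (path_reverse a) = path_class X y x (path_reverse b)"
    proof (rule path_class_eqI_close[OF X path_reverse_in_paths[OF X a]
          path_reverse_in_paths[OF X b]])
      show "fst (path_reverse a) = fst (path_reverse b)" by (simp add: len ab)
      fix i assume "i \<le> fst (path_reverse a)"
      then have i: "i \<le> fst a" by (simp only: len)
      then show "snd (path_reverse a) i = snd (path_reverse b) i \<or>
          adj X (snd (path_reverse a) i) (snd (path_reverse b) i)"
        using rev[of i a] rev[of i b] cl[of "fst a - i"] ab by simp
    qed
  }
qed

lemma path_map_in_paths:
  assumes "simple_graph X" "simple_graph Y" "graph_map X Y f" "p \<in> paths X x y"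
  shows "path_map f p \<in> paths Y (f x) (f y)"
proof -
  have "f (snd p i) = f (snd p (Suc i)) \<or> adj Y (f (snd p i)) (f (snd p (Suc i)))"
    if "i < fst p" for i
    using assms that unfolding paths_iff[OF assms(1)] graph_map_def by metis
  then show ?thesis
    using assms by (auto simp: paths_iff path_map_def graph_comp_def compose_def graph_map_def)
qed

lemma path_class_map_cong:
  assumes X: "simple_graph X" and Y: "simple_graph Y" and f: "graph_map X Y f"
    and p: "p \<in> paths X x y" "p' \<in> paths X x y" "path_class X x y p = path_class X x y p'"
  shows "path_class Y (f x) (f y) (path_map f p) = path_class Y (f x) (f y) (path_map f p')"
proof (rule path_class_lift[OF X _ _ p, where F = "\<lambda>p. path_class Y (f x) (f y) (path_map f p)"])
  have len: "fst (path_map f r) = fst r" for r by (simp add: path_map_def)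
  have pm: "snd (path_map f r) i = f (snd r i)" if "i \<le> fst r" for r i
    using that by (simp add: path_map_def graph_comp_def compose_def)
  {
    fix a b assume "shrink_step X x y a b"
    then obtain s where a: "a \<in> paths X x y" and b: "b \<in> paths X x y"
      and s: "shrinking (fst b) (fst a) s"
      and sb: "\<And>i. i \<le> fst b \<Longrightarrow> snd b i = snd a (s i)"
      and sl: "\<And>i. i \<le> fst b \<Longrightarrow> s i \<le> fst a"
      by (rule shrink_stepE[OF X]) blast
    have sh: "shrinking (fst (path_map f b)) (fst (path_map f a)) s" using s by (simp only: len)
    show "path_class Y (f x) (f y) (path_map f a) = path_class Y (f x) (f y) (path_map f b)"
    proof (rule path_class_eqI_reparam[OF Y path_map_in_paths[OF X Y f a]
          path_map_in_paths[OF X Y f b] sh])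
      fix i assume "i \<le> fst (path_map f b)"
      then have i: "i \<le> fst b" by (simp only: len)
      then show "snd (path_map f b) i = snd (path_map f a) (s i)"
        using pm[OF i] pm[OF sl[OF i]] sb[OF i] by simp
    qed
  next
    fix a b assume "adj (coprod_path_graph X x y) a b"
    then have a: "a \<in> paths X x y" and b: "b \<in> paths X x y" and ab: "fst a = fst b"
      and cl: "\<And>i. i \<le> fst a \<Longrightarrow> snd a i = snd b i \<or> adj X (snd a i) (snd b i)"
      unfolding adj_coprod_path_graph_iff by blast+
    show "path_class Y (f x) (f y) (path_map f a) = path_class Y (f x) (f y) (path_map f b)"
    proof (rule path_class_eqI_close[OF Y path_map_in_paths[OF X Y f a]
          path_map_in_paths[OF X Y f b]])
      show "fst (path_map f a) = fst (path_map f b)" by (simp add: len ab)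
      fix i assume "i \<le> fst (path_map f a)"
      then have i: "i \<le> fst a" by (simp only: len)
      then have "f (snd a i) = f (snd b i) \<or> adj Y (f (snd a i)) (f (snd b i))"
        using cl[OF i] f unfolding graph_map_def by metis
      then show "snd (path_map f a) i = snd (path_map f b) i \<or>
          adj Y (snd (path_map f a) i) (snd (path_map f b) i)"
        using pm[of i a] pm[of i b] i ab by simp
    qed
  }
qed

lemma Comp_Pi1:
  assumes X: "simple_graph X" and p: "p \<in> paths X x y" and q: "q \<in> paths X y z"
  shows "Comp (Pi1 X) x y z (path_class X y z q) (path_class X x y p) = path_class X x z (p \<star> q)"
proof -
  have "the_elem ((\<lambda>(p, q). path_class X x z (p \<star> q)) `
          (\<Union>(path_class X x y p) \<times> \<Union>(path_class X y z q))) =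
        (\<lambda>(p, q). path_class X x z (p \<star> q)) (p, q)"
  proof (rule the_elem_image_const)
    show "(p, q) \<in> \<Union>(path_class X x y p) \<times> \<Union>(path_class X y z q)"
      unfolding Union_path_class[OF X p] Union_path_class[OF X q] using p q by simp
    fix b assume b: "b \<in> \<Union>(path_class X x y p) \<times> \<Union>(path_class X y z q)"
    obtain c d where cd: "b = (c, d)" by (cases b)
    show "(\<lambda>(p, q). path_class X x z (p \<star> q)) b = (\<lambda>(p, q). path_class X x z (p \<star> q)) (p, q)"
      using b unfolding cd Union_path_class[OF X p] Union_path_class[OF X q] split_conv
      by (intro path_class_concat_cong[OF X _ p _ _ q]) simp_all
  qed
  then show ?thesis by (simp add: Pi1_def)
qed

lemma Inv_Pi1:
  assumes X: "simple_graph X" and p: "p \<in> paths X x y"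
  shows "Inv (Pi1 X) x y (path_class X x y p) = path_class X y x (path_reverse p)"
proof -
  have "the_elem ((\<lambda>p. path_class X y x (path_reverse p)) ` \<Union>(path_class X x y p)) =
        path_class X y x (path_reverse p)"
  proof (rule the_elem_image_const)
    show "p \<in> \<Union>(path_class X x y p)" unfolding Union_path_class[OF X p] using p by simp
    fix b assume "b \<in> \<Union>(path_class X x y p)"
    then show "path_class X y x (path_reverse b) = path_class X y x (path_reverse p)"
      unfolding Union_path_class[OF X p] by (intro path_class_reverse_cong[OF X _ p]) simp_all
  qed
  then show ?thesis by (simp add: Pi1_def)
qed

lemma farr_Pi1_map:
  assumes X: "simple_graph X" and Y: "simple_graph Y" and f: "graph_map X Y f"
    and p: "p \<in> paths X x y"
  shows "farr (Pi1_map Y f) x y (path_class X x y p) = path_class Y (f x) (f y) (path_map f p)"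
proof -
  have "the_elem ((\<lambda>p. path_class Y (f x) (f y) (path_map f p)) ` \<Union>(path_class X x y p)) =
        path_class Y (f x) (f y) (path_map f p)"
  proof (rule the_elem_image_const)
    show "p \<in> \<Union>(path_class X x y p)" unfolding Union_path_class[OF X p] using p by simp
    fix b assume "b \<in> \<Union>(path_class X x y p)"
    then show "path_class Y (f x) (f y) (path_map f b) = path_class Y (f x) (f y) (path_map f p)"
      unfolding Union_path_class[OF X p] by (intro path_class_map_cong[OF X Y f _ p]) simp_all
  qed
  then show ?thesis by (simp add: Pi1_map_def)
qed

lemma path_box_left_eq_map:
  assumes "simple_graph X" "p \<in> paths X x x'"
  shows "path_box_left p y = path_map (\<lambda>u\<in>verts X. (u, y)) p"
  using assms by (auto simp: path_box_left_def path_map_def graph_comp_def compose_def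
      paths_iff fun_eq_iff)

lemma path_box_right_eq_map:
  assumes "simple_graph Y" "q \<in> paths Y y y'"
  shows "path_box_right x q = path_map (\<lambda>v\<in>verts Y. (x, v)) q"
  using assms by (auto simp: path_box_right_def path_map_def graph_comp_def compose_def
      paths_iff fun_eq_iff)

lemma paths_endpoints:
  assumes "simple_graph X" "p \<in> paths X x x'"
  shows "x \<in> verts X" "x' \<in> verts X"
  using assms by (auto simp: paths_iff)

lemma farr_Phi:
  assumes X: "simple_graph X" and Y: "simple_graph Y"
    and p: "p \<in> paths X x x'" and q: "q \<in> paths Y y y'"
  shows "farr (Phi X Y) (x, y) (x', y') (path_class X x x' p, path_class Y y y' q) =
         path_class (X \<box> Y) (x, y) (x', y') (path_box_left p y \<star> path_box_right x' q)"
proof -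
  note B = simple_graph_box[OF X Y]
  let ?l = "\<lambda>u\<in>verts X. (u, y)" and ?r = "\<lambda>v\<in>verts Y. (x', v)"
  note e = paths_endpoints[OF X p] paths_endpoints[OF Y q]
  have l: "graph_map X (X \<box> Y) ?l" and r: "graph_map Y (X \<box> Y) ?r"
    using e simple_graphD[OF X] simple_graphD[OF Y] by (auto simp: graph_map_def box_def)
  have lp: "path_box_left a y \<in> paths (X \<box> Y) (x, y) (x', y)" if "a \<in> paths X x x'" for a
    using path_map_in_paths[OF X B l that] path_box_left_eq_map[OF X that, of y] e by simp
  have rp: "path_box_right x' b \<in> paths (X \<box> Y) (x', y) (x', y')" if "b \<in> paths Y y y'" for b
    using path_map_in_paths[OF Y B r that] path_box_right_eq_map[OF Y that, of x'] e by simp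
  have lc: "path_class (X \<box> Y) (x, y) (x', y) (path_box_left a y) =
        path_class (X \<box> Y) (x, y) (x', y) (path_box_left p y)"
    if "a \<in> paths X x x'" "path_class X x x' a = path_class X x x' p" for a
    using path_class_map_cong[OF X B l that(1) p that(2)] e
      path_box_left_eq_map[OF X that(1), of y] path_box_left_eq_map[OF X p, of y] by simp
  have rc: "path_class (X \<box> Y) (x', y) (x', y') (path_box_right x' b) =
        path_class (X \<box> Y) (x', y) (x', y') (path_box_right x' q)"
    if "b \<in> paths Y y y'" "path_class Y y y' b = path_class Y y y' q" for b
    using path_class_map_cong[OF Y B r that(1) q that(2)] e
      path_box_right_eq_map[OF Y that(1), of x'] path_box_right_eq_map[OF Y q, of x'] by simp
  let ?h = "\<lambda>(a, b). path_class (X \<box> Y) (x, y) (x', y') (path_box_left a y \<star> path_box_right x' b)"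
  have "the_elem (?h ` (\<Union>(path_class X x x' p) \<times> \<Union>(path_class Y y y' q))) = ?h (p, q)"
  proof (rule the_elem_image_const)
    show "(p, q) \<in> \<Union>(path_class X x x' p) \<times> \<Union>(path_class Y y y' q)"
      unfolding Union_path_class[OF X p] Union_path_class[OF Y q] using p q by simp
    fix b assume b: "b \<in> \<Union>(path_class X x x' p) \<times> \<Union>(path_class Y y y' q)"
    obtain c d where cd: "b = (c, d)" by (cases b)
    from b have c: "c \<in> paths X x x'" "path_class X x x' c = path_class X x x' p"
      and d: "d \<in> paths Y y y'" "path_class Y y y' d = path_class Y y y' q"
      unfolding cd Union_path_class[OF X p] Union_path_class[OF Y q] by simp_all
    show "?h b = ?h (p, q)"
      unfolding cd split_conv
      by (rule path_class_concat_cong[OF B lp[OF c(1)] lp[OF p] lc[OF c]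
            rp[OF d(1)] rp[OF q] rc[OF d]])
  qed
  then show ?thesis by (simp add: Phi_def)
qed

end

theory Submission
  imports Defs
begin

text \<open>
  The projections give the functor \<open>\<Psi>\<close> for free, so \<open>\<Phi>\<close> need not be shown functorial by
  hand: it suffices that it inverts \<open>\<Psi>\<close> on hom-sets. One composite only inserts constant
  subpaths. For the other, every path in \<open>X \<box> Y\<close> must be deformed into its \<open>X\<close>-part followed by
  its \<open>Y\<close>-part; by induction on the length this reduces to moving a single \<open>X\<close>-edge past a path
  in \<open>Y\<close>. Naturality and coherence then hold on representatives, as equalities of paths.
\<close>

section \<open>Paths\<close>

text \<open>The representatives that \<open>Phi\<close> produces are not closed under concatenation:
  an X-part followed by a Y-part, twice in a row, has an X-part in the wrong place. A direct proof
  that \<open>Phi\<close> respects composition would therefore already contain the interchange of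
  X-steps and Y-steps. Inheriting functoriality from \<open>Psi\<close> confines this interchange to
  the single identity for \<open>Phi\<close> after \<open>Psi\<close>. Paths are identified by two
  moves of different kinds: a shrinking map changes the length but not the route, while adjacency in
  the path graph changes the route but only compares paths of equal length. Constant pieces, called
  stalls, mediate between them: they cost nothing up to shrinking, and inserting them aligns two
  routes until they are equal or adjacent at every index. Since adjacent paths may differ by an edge
  at many indices at once, an X-edge passes a whole Y-path in a single move, with no induction along
  the Y-path.\<close>

lemma path_eqI:
  assumes "simple_graph X" "p \<in> paths X x y" "q \<in> paths X x' y'" "fst p = fst q"
    and "\<And>i. i \<le> fst p \<Longrightarrow> snd p i = snd q i"
  shows "p = q"
proof (rule prod_eqI)
  have "snd p \<in> extensional {..fst p}" "snd q \<in> extensional {..fst p}"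
    using assms(2-4) unfolding paths_iff[OF assms(1)] by auto
  then show "snd p = snd q"
    by (rule extensionalityI) (use assms(5) in auto)
qed (rule assms(4))

lemma path_const_in_paths:
  assumes "simple_graph X" "x \<in> verts X"
  shows "path_const x \<in> paths X x x"
  using assms by (simp add: paths_iff path_const_def)

lemma path_const_concat:
  assumes X: "simple_graph X" and p: "p \<in> paths X x y"
  shows "path_const x \<star> p = p"
proof -
  have c: "path_const x \<in> paths X x x"
    by (rule path_const_in_paths[OF X paths_endpoints(1)[OF X p]])
  show ?thesis
  proof (rule path_eqI[OF X path_concat_in_paths[OF X c p] p])
    fix i assume "i \<le> fst (path_const x \<star> p)"
    then show "snd (path_const x \<star> p) i = snd p i"
      using path_concat_right[OF X c p, of i] by (simp add: fst_path_concat path_const_def)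
  qed (simp add: fst_path_concat path_const_def)
qed

lemma path_concat_const:
  assumes X: "simple_graph X" and p: "p \<in> paths X x y"
  shows "p \<star> path_const y = p"
proof -
  have c: "path_const y \<in> paths X y y"
    by (rule path_const_in_paths[OF X paths_endpoints(2)[OF X p]])
  show ?thesis
    by (rule path_eqI[OF X path_concat_in_paths[OF X p c] p])
      (simp_all add: fst_path_concat path_const_def path_concat_left)
qed

text \<open>Lengths add and nothing is rescaled, so associativity is an equality of paths rather
  than a homotopy. The coherence of \<open>Phi\<close> with the associator rests on this strict
  form.\<close>

lemma path_concat_assoc:
  assumes X: "simple_graph X"
    and p: "p \<in> paths X w x" and q: "q \<in> paths X x y" and r: "r \<in> paths X y z"
  shows "(p \<star> q) \<star> r = p \<star> q \<star> r"
proof (rule path_eqI[OF X path_concat_in_paths[OF X path_concat_in_paths[OF X p q] r]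
      path_concat_in_paths[OF X p path_concat_in_paths[OF X q r]]])
  fix i assume "i \<le> fst ((p \<star> q) \<star> r)"
  then show "snd ((p \<star> q) \<star> r) i = snd (p \<star> q \<star> r) i"
    by (auto simp: path_concat_def)
qed (simp add: fst_path_concat)

section \<open>Images of paths under vertex functions\<close>

lemma path_map_const: "path_map f (path_const x) = path_const (f x)"
  by (auto simp: path_map_def path_const_def graph_comp_def compose_def fun_eq_iff)

lemma path_map_concat: "path_map f (p \<star> q) = path_map f p \<star> path_map f q"
  by (auto simp: path_map_def path_concat_def graph_comp_def compose_def fun_eq_iff)

lemma path_map_path_map: "path_map g (path_map f p) = path_map (\<lambda>x. g (f x)) p"
  by (auto simp: path_map_def graph_comp_def compose_def fun_eq_iff)

text \<open>A path meets only vertices of its graph. This allows restricted maps such as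
  \<open>graph_id X\<close> or \<open>box_fst X Y\<close> to be traded for the total functions that
  they restrict.\<close>

lemma path_map_cong:
  assumes "simple_graph X" "p \<in> paths X x y" "\<And>v. v \<in> verts X \<Longrightarrow> f v = g v"
  shows "path_map f p = path_map g p"
  using assms by (auto simp: path_map_def graph_comp_def compose_def fun_eq_iff paths_iff)

lemma path_map_ident:
  assumes "simple_graph X" "p \<in> paths X x y"
  shows "path_map (\<lambda>v. v) p = p"
  using assms
  by (auto simp: path_map_def graph_comp_def compose_def paths_iff extensional_def
      fun_eq_iff prod_eq_iff)

text \<open>Padding of arbitrary length, used to delay a path; \<open>path_const\<close> is the case
  of length 0.\<close>

definition path_stall :: "nat \<Rightarrow> 'a \<Rightarrow> 'a path" where
  "path_stall n x = (n, \<lambda>i\<in>verts (interval n). x)"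

text \<open>The case \<open>x = y\<close> is deliberately included: a step of a path may stand
  still, and projecting a step of a box product to the coordinate that does not move gives such a
  step.\<close>

definition path_edge :: "'a \<Rightarrow> 'a \<Rightarrow> 'a path" where
  "path_edge x y = (1, \<lambda>i\<in>verts (interval 1). if i = 0 then x else y)"

lemma path_stall_in_paths:
  assumes "simple_graph X" "x \<in> verts X"
  shows "path_stall n x \<in> paths X x x"
  using assms by (simp add: paths_iff path_stall_def)

lemma path_edge_in_paths:
  assumes "simple_graph X" "x \<in> verts X" "y \<in> verts X" "x = y \<or> adj X x y"
  shows "path_edge x y \<in> paths X x y"
  using assms by (auto simp: paths_iff path_edge_def)

text \<open>The constant map from \<open>I_n\<close> to \<open>I_0\<close> is shrinking, and a stall
  is the path of length 0 precomposed with it.\<close>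

lemma path_class_stall:
  assumes X: "simple_graph X" and x: "x \<in> verts X"
  shows "path_class X x x (path_stall n x) = path_class X x x (path_const x)"
proof -
  have s: "shrinking (fst (path_stall n x)) (fst (path_const x)) (\<lambda>i\<in>{..n}. 0)"
    by (simp add: shrinking_iff path_stall_def path_const_def)
  show ?thesis
    by (rule path_class_eqI_reparam[OF X path_const_in_paths[OF X x] path_stall_in_paths[OF X x] s,
          symmetric]) (simp add: path_stall_def path_const_def)
qed

lemma path_class_concat_stall:
  assumes X: "simple_graph X" and p: "p \<in> paths X x y"
  shows "path_class X x y (p \<star> path_stall n y) = path_class X x y p"
proof -
  note y = paths_endpoints(2)[OF X p]
  show ?thesis
    using path_class_concat_cong[OF X p p refl path_stall_in_paths[OF X y]
        path_const_in_paths[OF X y] path_class_stall[OF X y]]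
    by (simp add: path_concat_const[OF X p])
qed

lemma path_class_stall_concat:
  assumes X: "simple_graph X" and p: "p \<in> paths X x y"
  shows "path_class X x y (path_stall n x \<star> p) = path_class X x y p"
proof -
  note x = paths_endpoints(1)[OF X p]
  show ?thesis
    using path_class_concat_cong[OF X path_stall_in_paths[OF X x] path_const_in_paths[OF X x]
        path_class_stall[OF X x] p p refl]
    by (simp add: path_const_concat[OF X p])
qed

text \<open>Supplies the induction on length for paths in a box product. The final step may be
  stationary, hence the alternative \<open>z = y\<close>.\<close>

lemma path_split_last:
  assumes X: "simple_graph X" and p: "p \<in> paths X x y" and n: "fst p = Suc n"
  obtains q z where "q \<in> paths X x z" "fst q = n" "z = y \<or> adj X z y" "p = q \<star> path_edge z y"
proof -
  let ?q = "(n, restrict (snd p) {..n})" and ?z = "snd p n"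
  have q: "?q \<in> paths X x ?z" and e: "?z = y \<or> adj X ?z y" and z: "?z \<in> verts X"
    using p n unfolding paths_iff[OF X] by auto
  note y = paths_endpoints(2)[OF X p]
  have "p = ?q \<star> path_edge ?z y"
    by (rule path_eqI[OF X p path_concat_in_paths[OF X q path_edge_in_paths[OF X z y e]]])
      (use n path_endpoint_eqs(2)[OF X p] in
        \<open>auto simp: path_concat_def path_edge_def le_Suc_eq\<close>)
  then show thesis using that[OF q _ e] by simp
qed

text \<open>The homotopy contracting \<open>p \<star> path_reverse p\<close> turns back after \<open>k\<close> steps, for decreasing
  \<open>k\<close>.\<close>

lemma path_class_concat_reverse:
  assumes X: "simple_graph X" and p: "p \<in> paths X x y"
  shows "path_class X x x (p \<star> path_reverse p) = path_class X x x (path_const x)"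
proof -
  define n where "n = fst p"
  \<comment> \<open>The tent \<open>min i (2 * n - i)\<close> climbs to \<open>n\<close> and
    returns, and the cap \<open>k\<close> cuts off its top: \<open>h k\<close> follows
    \<open>p\<close> up to index \<open>k\<close>, waits, and comes back. All stages have length
    \<open>2 * n\<close>, so consecutive ones can be compared; the cap \<open>n\<close> cuts off
    nothing and the cap 0 leaves a stall at \<open>x\<close>.\<close>
  define h where "h k = (2 * n, \<lambda>i\<in>{..2 * n}. snd p (min k (min i (2 * n - i))))" for k
  have pv: "\<And>i. i \<le> n \<Longrightarrow> snd p i \<in> verts X"
    and ps: "\<And>i. i < n \<Longrightarrow> snd p i = snd p (Suc i) \<or> adj X (snd p i) (snd p (Suc i))"
    and p0: "snd p 0 = x" and p1: "snd p n = y"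
    using p unfolding paths_iff[OF X] n_def by blast+
  have near: "snd p i = snd p j \<or> adj X (snd p i) (snd p j)"
    if "i \<le> n" "j \<le> n" "i = j \<or> j = Suc i \<or> i = Suc j" for i j
    using that ps[of i] ps[of j] simple_graphD(4)[OF X] by (metis Suc_le_eq)
  have x: "x \<in> verts X" using pv p0 by fastforce
  have h: "h k \<in> paths X x x" for k
    unfolding paths_iff[OF X]
  proof (intro conjI allI impI)
    fix i assume i: "i < fst (h k)"
    \<comment> \<open>The capped tent changes by at most one between consecutive indices, so each
      stage is a path.\<close>
    let ?a = "min k (min i (2 * n - i))" and ?b = "min k (min (Suc i) (2 * n - Suc i))"
    have "?a \<le> n" "?b \<le> n" "?a = ?b \<or> ?b = Suc ?a \<or> ?a = Suc ?b"
      using i unfolding h_def fst_conv by linarith+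
    from near[OF this]
    show "snd (h k) i = snd (h k) (Suc i) \<or> adj X (snd (h k) i) (snd (h k) (Suc i))"
      using i by (simp add: h_def)
  qed (auto simp: h_def p0 intro!: pv)
  have "path_class X x x (h k) = path_class X x x (h 0)" for k
  proof (induction k)
    case (Suc k)
    have "path_class X x x (h (Suc k)) = path_class X x x (h k)"
    proof (rule path_class_eqI_close[OF X h h])
      fix i assume i: "i \<le> fst (h (Suc k))"
      \<comment> \<open>Raising the cap by one changes the value at a fixed index by at most one, so
        consecutive stages are close.\<close>
      let ?a = "min (Suc k) (min i (2 * n - i))" and ?b = "min k (min i (2 * n - i))"
      have "?a \<le> n" "?b \<le> n" "?a = ?b \<or> ?b = Suc ?a \<or> ?a = Suc ?b"
        using i unfolding h_def fst_conv by linarith+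
      from near[OF this]
      show "snd (h (Suc k)) i = snd (h k) i \<or> adj X (snd (h (Suc k)) i) (snd (h k) i)"
        using i by (simp add: h_def)
    qed (simp add: h_def)
    with Suc show ?case by simp
  qed simp
  moreover have "h 0 = path_stall (2 * n) x"
    by (simp add: h_def path_stall_def p0)
  moreover have "h n = p \<star> path_reverse p"
  proof (rule path_eqI[OF X h path_concat_in_paths[OF X p path_reverse_in_paths[OF X p]]])
    fix i assume "i \<le> fst (h n)"
    then show "snd (h n) i = snd (p \<star> path_reverse p) i"
      by (auto simp: h_def path_concat_def path_reverse_def n_def min_def mult_2
          intro!: arg_cong[of _ _ "snd p"])
  qed (simp add: h_def path_concat_def path_reverse_def n_def)
  ultimately show ?thesis using path_class_stall[OF X x] by metis
qed

lemma path_reverse_reverse: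
  assumes "simple_graph X" "p \<in> paths X x y"
  shows "path_reverse (path_reverse p) = p"
  by (rule path_eqI[OF assms(1) path_reverse_in_paths[OF assms(1) path_reverse_in_paths[OF assms]]
        assms(2)]) (simp_all add: path_reverse_def)

section \<open>The fundamental groupoid functor\<close>

lemma Ob_Pi1: "Ob (Pi1 X) = verts X"
  by (simp add: Pi1_def)

lemma Ident_Pi1: "Ident (Pi1 X) x = path_class X x x (path_const x)"
  by (simp add: Pi1_def)

lemma Hom_Pi1E:
  assumes "a \<in> Hom (Pi1 X) x y"
  obtains p where "p \<in> paths X x y" "a = path_class X x y p"
  using assms unfolding Hom_Pi1 by blast

lemma path_class_in_Hom: "p \<in> paths X x y \<Longrightarrow> path_class X x y p \<in> Hom (Pi1 X) x y"
  unfolding Hom_Pi1 by blast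

text \<open>Once morphisms are replaced by representatives, the unit and associativity laws are
  equalities of paths; only the inverse laws need a homotopy.\<close>

lemma groupoid_Pi1:
  assumes X: "simple_graph X"
  shows "groupoid (Pi1 X)"
  unfolding groupoid_def Ob_Pi1
proof (intro conjI ballI; (elim Hom_Pi1E)?)
  fix x assume x: "x \<in> verts X"
  show "Ident (Pi1 X) x \<in> Hom (Pi1 X) x x"
    unfolding Ident_Pi1 by (rule path_class_in_Hom[OF path_const_in_paths[OF X x]])
next
  fix x y z a b p q
  assume p: "p \<in> paths X x y" and q: "q \<in> paths X y z"
    and ab: "a = path_class X x y p" "b = path_class X y z q"
  show "Comp (Pi1 X) x y z b a \<in> Hom (Pi1 X) x z"
    unfolding ab Comp_Pi1[OF X p q] by (rule path_class_in_Hom[OF path_concat_in_paths[OF X p q]])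
next
  fix x y a p
  assume x: "x \<in> verts X" and y: "y \<in> verts X"
    and p: "p \<in> paths X x y" and a: "a = path_class X x y p"
  show "Comp (Pi1 X) x x y a (Ident (Pi1 X) x) = a"
    unfolding a Ident_Pi1 Comp_Pi1[OF X path_const_in_paths[OF X x] p] path_const_concat[OF X p] ..
  show "Comp (Pi1 X) x y y (Ident (Pi1 X) y) a = a"
    unfolding a Ident_Pi1 Comp_Pi1[OF X p path_const_in_paths[OF X y]] path_concat_const[OF X p] ..
  note r = path_reverse_in_paths[OF X p]
  show "Inv (Pi1 X) x y a \<in> Hom (Pi1 X) y x"
    unfolding a Inv_Pi1[OF X p] by (rule path_class_in_Hom[OF r])
  show "Comp (Pi1 X) x y x (Inv (Pi1 X) x y a) a = Ident (Pi1 X) x"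
    unfolding a Inv_Pi1[OF X p] Comp_Pi1[OF X p r] Ident_Pi1
    by (rule path_class_concat_reverse[OF X p])
  show "Comp (Pi1 X) y x y a (Inv (Pi1 X) x y a) = Ident (Pi1 X) y"
    unfolding a Inv_Pi1[OF X p] Comp_Pi1[OF X r p] Ident_Pi1
    \<comment> \<open>The second inverse law is the first one applied to the reversed path.\<close>
    using path_class_concat_reverse[OF X r] unfolding path_reverse_reverse[OF X p] .
next
  fix w x y z a b c p q r
  assume p: "p \<in> paths X w x" and q: "q \<in> paths X x y" and r: "r \<in> paths X y z"
    and abc: "a = path_class X w x p" "b = path_class X x y q" "c = path_class X y z r"
  show "Comp (Pi1 X) w x z (Comp (Pi1 X) x y z c b) a =
      Comp (Pi1 X) w y z c (Comp (Pi1 X) w x y b a)"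
    by (simp only: abc Comp_Pi1[OF X] p q r path_concat_in_paths[OF X p q]
        path_concat_in_paths[OF X q r] path_concat_assoc[OF X p q r])
qed

section \<open>Functoriality in the graph\<close>

lemma fobj_Pi1_map: "fobj (Pi1_map Y f) = f"
  by (simp add: Pi1_map_def)

lemma graph_map_verts: "graph_map X Y f \<Longrightarrow> x \<in> verts X \<Longrightarrow> f x \<in> verts Y"
  by (auto simp: graph_map_def)

lemma is_functor_Pi1_map:
  assumes X: "simple_graph X" and Y: "simple_graph Y" and f: "graph_map X Y f"
  shows "is_functor (Pi1 X) (Pi1 Y) (Pi1_map Y f)"
  unfolding is_functor_def Ob_Pi1 fobj_Pi1_map
proof (intro conjI ballI; (elim Hom_Pi1E)?)
  fix x assume x: "x \<in> verts X"
  show "f x \<in> verts Y" by (rule graph_map_verts[OF f x])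
  show "farr (Pi1_map Y f) x x (Ident (Pi1 X) x) = Ident (Pi1 Y) (f x)"
    unfolding Ident_Pi1 farr_Pi1_map[OF X Y f path_const_in_paths[OF X x]] path_map_const ..
next
  fix x y a p assume p: "p \<in> paths X x y" and a: "a = path_class X x y p"
  show "farr (Pi1_map Y f) x y a \<in> Hom (Pi1 Y) (f x) (f y)"
    unfolding a farr_Pi1_map[OF X Y f p]
    by (rule path_class_in_Hom[OF path_map_in_paths[OF X Y f p]])
next
  fix x y z a b p q
  assume p: "p \<in> paths X x y" and q: "q \<in> paths X y z"
    and ab: "a = path_class X x y p" "b = path_class X y z q"
  show "farr (Pi1_map Y f) x z (Comp (Pi1 X) x y z b a) =
      Comp (Pi1 Y) (f x) (f y) (f z) (farr (Pi1_map Y f) y z b) (farr (Pi1_map Y f) x y a)"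
    unfolding ab Comp_Pi1[OF X p q] farr_Pi1_map[OF X Y f p] farr_Pi1_map[OF X Y f q]
      farr_Pi1_map[OF X Y f path_concat_in_paths[OF X p q]] path_map_concat
      Comp_Pi1[OF Y path_map_in_paths[OF X Y f p] path_map_in_paths[OF X Y f q]] ..
qed

lemma graph_map_id:
  assumes "simple_graph X"
  shows "graph_map X X (graph_id X)"
  using simple_graphD[OF assms] by (auto simp: graph_map_def graph_id_def)

lemma graph_map_comp:
  assumes "simple_graph X" "graph_map X Y f" "graph_map Y Z g"
  shows "graph_map X Z (graph_comp X g f)"
proof -
  have "g (f x) = g (f y) \<or> adj Z (g (f x)) (g (f y))" if "adj X x y" for x y
    using assms(2,3) that unfolding graph_map_def by metis
  then show ?thesis
    using assms(2,3) simple_graphD[OF assms(1)]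
    by (auto simp: graph_map_def graph_comp_def compose_def)
qed

lemma Pi1_map_id:
  assumes X: "simple_graph X"
  shows "functor_eq (Pi1 X) (Pi1_map X (graph_id X)) functor_id"
  unfolding functor_eq_def Ob_Pi1 fobj_Pi1_map
proof (intro conjI ballI; (elim Hom_Pi1E)?)
  fix x y a p assume p: "p \<in> paths X x y" and a: "a = path_class X x y p"
  have "path_map (graph_id X) p = p"
    using path_map_cong[OF X p, of "graph_id X" "\<lambda>v. v"] path_map_ident[OF X p]
    by (simp add: graph_id_def)
  then show "farr (Pi1_map X (graph_id X)) x y a = farr functor_id x y a"
    unfolding a farr_Pi1_map[OF X X graph_map_id[OF X] p]
    using paths_endpoints[OF X p] by (simp add: functor_id_def graph_id_def)
qed (simp add: functor_id_def graph_id_def)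

lemma Pi1_map_comp:
  assumes X: "simple_graph X" and Y: "simple_graph Y" and Z: "simple_graph Z"
    and f: "graph_map X Y f" and g: "graph_map Y Z g"
  shows "functor_eq (Pi1 X) (Pi1_map Z (graph_comp X g f)) (Pi1_map Z g \<circ>\<^sub>F Pi1_map Y f)"
  unfolding functor_eq_def Ob_Pi1
proof (intro conjI ballI; (elim Hom_Pi1E)?)
  fix x assume "x \<in> verts X"
  then show "fobj (Pi1_map Z (graph_comp X g f)) x = fobj (Pi1_map Z g \<circ>\<^sub>F Pi1_map Y f) x"
    by (simp add: fobj_Pi1_map functor_comp_def graph_comp_def compose_def)
next
  fix x y a p assume p: "p \<in> paths X x y" and a: "a = path_class X x y p"
  have "path_map (graph_comp X g f) p = path_map g (path_map f p)"
    unfolding path_map_path_map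
    by (rule path_map_cong[OF X p]) (simp add: graph_comp_def compose_def)
  then show "farr (Pi1_map Z (graph_comp X g f)) x y a = farr (Pi1_map Z g \<circ>\<^sub>F Pi1_map Y f) x y a"
    unfolding a farr_Pi1_map[OF X Z graph_map_comp[OF X f g] p]
    using paths_endpoints[OF X p]
    by (simp add: functor_comp_def fobj_Pi1_map farr_Pi1_map[OF X Y f p]
        farr_Pi1_map[OF Y Z g path_map_in_paths[OF X Y f p]] graph_comp_def compose_def)
qed


section \<open>Paths in box products\<close>

lemma verts_box: "verts (X \<box> Y) = verts X \<times> verts Y"
  by (simp add: box_def)

lemma adj_box:
  "adj (X \<box> Y) (x, y) (x', y') \<longleftrightarrow>
     adj X x x' \<and> y = y' \<and> y \<in> verts Y \<or> x = x' \<and> x \<in> verts X \<and> adj Y y y'"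
  by (simp add: box_def)

section \<open>Paths that move in one coordinate\<close>

lemma path_box_left_in_paths:
  assumes "simple_graph X" "simple_graph Y" "p \<in> paths X x x'" "y \<in> verts Y"
  shows "path_box_left p y \<in> paths (X \<box> Y) (x, y) (x', y)"
  using assms by (auto simp: paths_iff simple_graph_box path_box_left_def verts_box adj_box)

lemma path_box_right_in_paths:
  assumes "simple_graph X" "simple_graph Y" "q \<in> paths Y y y'" "x \<in> verts X"
  shows "path_box_right x q \<in> paths (X \<box> Y) (x, y) (x, y')"
  using assms by (auto simp: paths_iff simple_graph_box path_box_right_def verts_box adj_box)

lemma path_box_in_paths:
  assumes X: "simple_graph X" and Y: "simple_graph Y"
    and p: "p \<in> paths X x x'" and q: "q \<in> paths Y y y'"
  shows "path_box_left p y \<star> path_box_right x' q \<in> paths (X \<box> Y) (x, y) (x', y')"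
  by (rule path_concat_in_paths[OF simple_graph_box[OF X Y]
        path_box_left_in_paths[OF X Y p paths_endpoints(1)[OF Y q]]
        path_box_right_in_paths[OF X Y q paths_endpoints(2)[OF X p]]])

lemma path_box_left_concat: "path_box_left (p \<star> q) y = path_box_left p y \<star> path_box_left q y"
  by (auto simp: path_box_left_def path_concat_def fun_eq_iff)

lemma path_box_right_concat: "path_box_right x (p \<star> q) = path_box_right x p \<star> path_box_right x q"
  by (auto simp: path_box_right_def path_concat_def fun_eq_iff)

lemma path_box_left_stall: "path_box_left (path_stall n x) y = path_stall n (x, y)"
  by (auto simp: path_box_left_def path_stall_def fun_eq_iff)

lemma path_box_right_stall: "path_box_right x (path_stall n y) = path_stall n (x, y)"
  by (auto simp: path_box_right_def path_stall_def fun_eq_iff)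

lemma path_box_left_edge: "path_box_left (path_edge x x') y = path_edge (x, y) (x', y)"
  by (auto simp: path_box_left_def path_edge_def fun_eq_iff)

lemma path_box_right_edge: "path_box_right x (path_edge y y') = path_edge (x, y) (x, y')"
  by (auto simp: path_box_right_def path_edge_def fun_eq_iff)

lemma path_edge_same: "path_edge x x = path_stall 1 x"
  by (auto simp: path_edge_def path_stall_def)

lemma path_map_edge: "path_map f (path_edge x y) = path_edge (f x) (f y)"
  by (auto simp: path_map_def path_edge_def graph_comp_def compose_def fun_eq_iff)

lemma path_map_fst_box_left:
  assumes "simple_graph X" "p \<in> paths X x x'"
  shows "path_map fst (path_box_left p y) = p"
  using assms
  by (auto simp: path_map_def path_box_left_def graph_comp_def compose_def paths_iff
      extensional_def fun_eq_iff prod_eq_iff)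

lemma path_map_snd_box_right:
  assumes "simple_graph Y" "q \<in> paths Y y y'"
  shows "path_map snd (path_box_right x q) = q"
  using assms
  by (auto simp: path_map_def path_box_right_def graph_comp_def compose_def paths_iff
      extensional_def fun_eq_iff prod_eq_iff)

lemma path_map_snd_box_left: "path_map snd (path_box_left p y) = path_stall (fst p) y"
  by (auto simp: path_map_def path_box_left_def graph_comp_def compose_def path_stall_def fun_eq_iff)

lemma path_map_fst_box_right: "path_map fst (path_box_right x q) = path_stall (fst q) x"
  by (auto simp: path_map_def path_box_right_def graph_comp_def compose_def path_stall_def fun_eq_iff)

text \<open>A step of the box product moves at most one coordinate, so its projection is a step or
  stands still. The total function \<open>fst\<close> is not extensional and hence not literally a
  graph map, so \<open>path_map_in_paths\<close> does not cover it.\<close>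

lemma path_map_fst_in_paths:
  assumes "simple_graph X" "simple_graph Y" "p \<in> paths (X \<box> Y) (x, y) (x', y')"
  shows "path_map fst p \<in> paths X x x'"
proof -
  have "fst a = fst b \<or> adj X (fst a) (fst b)" if "a = b \<or> adj (X \<box> Y) a b" for a b
    using that by (cases a; cases b) (auto simp: adj_box)
  moreover have "fst a \<in> verts X" if "a \<in> verts (X \<box> Y)" for a
    using that by (auto simp: verts_box)
  ultimately show ?thesis
    using assms by (simp add: paths_iff simple_graph_box path_map_def graph_comp_def compose_def)
qed

lemma path_map_snd_in_paths:
  assumes "simple_graph X" "simple_graph Y" "p \<in> paths (X \<box> Y) (x, y) (x', y')"
  shows "path_map snd p \<in> paths Y y y'"
proof -
  have "snd a = snd b \<or> adj Y (snd a) (snd b)" if "a = b \<or> adj (X \<box> Y) a b" for a b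
    using that by (cases a; cases b) (auto simp: adj_box)
  moreover have "snd a \<in> verts Y" if "a \<in> verts (X \<box> Y)" for a
    using that by (auto simp: verts_box)
  ultimately show ?thesis
    using assms by (simp add: paths_iff simple_graph_box path_map_def graph_comp_def compose_def)
qed

text \<open>The two ways around the rectangle are not pointwise adjacent, but they become so after
  delaying one of them by a step at its start and the other by a step at its end.\<close>

lemma path_class_edge_interchange:
  assumes X: "simple_graph X" and Y: "simple_graph Y"
    and u: "u \<in> verts X" "u' \<in> verts X" "u = u' \<or> adj X u u'" and q: "q \<in> paths Y y y'"
  shows "path_class (X \<box> Y) (u, y) (u', y')
           (path_box_left (path_edge u u') y \<star> path_box_right u' q) =
         path_class (X \<box> Y) (u, y) (u', y')
           (path_box_right u q \<star> path_box_left (path_edge u u') y')"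
proof -
  note B = simple_graph_box[OF X Y] and e = path_edge_in_paths[OF X u]
  let ?A = "path_box_left (path_edge u u') y \<star> path_box_right u' q"
    and ?B = "path_box_right u q \<star> path_box_left (path_edge u u') y'"
  have A: "?A \<in> paths (X \<box> Y) (u, y) (u', y')" by (rule path_box_in_paths[OF X Y e q])
  have B': "?B \<in> paths (X \<box> Y) (u, y) (u', y')"
    by (rule path_concat_in_paths[OF B path_box_right_in_paths[OF X Y q u(1)]
          path_box_left_in_paths[OF X Y e paths_endpoints(2)[OF Y q]]])
  note ends = path_endpoint_eqs[OF Y q]
  have qv: "\<And>j. j \<le> fst q \<Longrightarrow> snd q j \<in> verts Y" using q unfolding paths_iff[OF Y] by blast
  have "path_class (X \<box> Y) (u, y) (u', y') (?A \<star> path_stall 1 (u', y')) =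
        path_class (X \<box> Y) (u, y) (u', y') (path_stall 1 (u, y) \<star> ?B)"
  proof (rule path_class_eqI_close[OF B])
    let ?A' = "?A \<star> path_stall 1 (u', y')" and ?B' = "path_stall 1 (u, y) \<star> ?B"
    show "?A' \<in> paths (X \<box> Y) (u, y) (u', y')"
      by (rule path_concat_in_paths[OF B A path_stall_in_paths[OF B paths_endpoints(2)[OF B A]]])
    show "?B' \<in> paths (X \<box> Y) (u, y) (u', y')"
      by (rule path_concat_in_paths[OF B path_stall_in_paths[OF B paths_endpoints(1)[OF B A]] B'])
    show "fst ?A' = fst ?B'"
      by (simp add: path_concat_def path_box_left_def path_box_right_def path_stall_def path_edge_def)
    fix i assume "i \<le> fst ?A'"
    then have "i \<le> Suc (Suc (fst q))"
      by (simp add: path_concat_def path_box_left_def path_box_right_def path_stall_def path_edge_def)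
    \<comment> \<open>Both delayed paths have length \<open>fst q + 2\<close> and agree at the two
      ends. At an inner index \<open>Suc j\<close>, \<open>?A'\<close> has already crossed the
      X-edge and \<open>?B'\<close> has used one step for waiting, so both lie over
      \<open>snd q j\<close> and differ by that edge alone.\<close>
    then consider "i = 0" | j where "i = Suc j" "j \<le> fst q" | "i = Suc (Suc (fst q))"
      by (metis le_SucE not0_implies_Suc Suc_le_mono)
    then show "snd ?A' i = snd ?B' i \<or> adj (X \<box> Y) (snd ?A' i) (snd ?B' i)"
    proof cases
      case (2 j)
      then have "snd ?A' i = (u', snd q j)" "snd ?B' i = (u, snd q j)"
        using ends
        by (auto simp: path_concat_def path_box_left_def path_box_right_def path_stall_def
            path_edge_def)
      then show ?thesis using u(3) qv[OF 2(2)] simple_graphD(4)[OF X] by (auto simp: adj_box)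
    qed (use ends in \<open>auto simp: path_concat_def path_box_left_def path_box_right_def
          path_stall_def path_edge_def\<close>)
  qed
  then show ?thesis
    unfolding path_class_concat_stall[OF B A] path_class_stall_concat[OF B B'] .
qed

text \<open>After the induction hypothesis has sorted all but the last step, a final Y-step is
  already in place, while a final X-step has to pass the whole Y-part by
  \<open>path_class_edge_interchange\<close>. In both cases the other projection receives a
  stationary step, which has to be accounted for by a stall.\<close>

lemma path_class_box_decomp:
  assumes X: "simple_graph X" and Y: "simple_graph Y"
    and r: "r \<in> paths (X \<box> Y) (x, y) (x', y')"
  shows "path_class (X \<box> Y) (x, y) (x', y')
           (path_box_left (path_map fst r) y \<star> path_box_right x' (path_map snd r)) =
         path_class (X \<box> Y) (x, y) (x', y') r"
  using r
proof (induction "fst r" arbitrary: r x' y')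
  case 0
  note B = simple_graph_box[OF X Y]
  have "path_box_left (path_map fst r) y \<star> path_box_right x' (path_map snd r) = r"
    using 0(1) path_endpoint_eqs[OF B 0(2)]
    by (intro path_eqI[OF B path_box_in_paths[OF X Y path_map_fst_in_paths[OF X Y 0(2)]
          path_map_snd_in_paths[OF X Y 0(2)]] 0(2)])
      (simp_all add: path_concat_def path_box_left_def path_box_right_def path_map_def
        graph_comp_def compose_def)
  then show ?case by simp
next
  case (Suc n)
  note B = simple_graph_box[OF X Y]
  obtain d w where d: "d \<in> paths (X \<box> Y) (x, y) w" and n: "fst d = n"
    and w: "w = (x', y') \<or> adj (X \<box> Y) w (x', y')" and r: "r = d \<star> path_edge w (x', y')"
    by (rule path_split_last[OF B Suc(3) Suc(2)[symmetric]])
  obtain u v where uv: "w = (u, v)" by (cases w)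
  note d = d[unfolded uv] and w = w[unfolded uv] and r = r[unfolded uv]
  define a where "a = path_map fst d"
  define b where "b = path_map snd d"
  have a: "a \<in> paths X x u" unfolding a_def by (rule path_map_fst_in_paths[OF X Y d])
  have b: "b \<in> paths Y y v" unfolding b_def by (rule path_map_snd_in_paths[OF X Y d])
  have rab: "path_map fst r = a \<star> path_edge u x'" "path_map snd r = b \<star> path_edge v y'"
    by (simp_all add: r a_def b_def path_map_concat path_map_edge)
  have "(u, v) \<in> verts (X \<box> Y)" "(x', y') \<in> verts (X \<box> Y)"
    using paths_endpoints(2)[OF B d] paths_endpoints(2)[OF B Suc(3)] by blast+
  then have V: "u \<in> verts X" "v \<in> verts Y" "x' \<in> verts X" "y' \<in> verts Y"
    by (simp_all add: verts_box)
  note y = paths_endpoints(1)[OF Y b]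
  note La = path_box_left_in_paths[OF X Y a y]
  have E: "path_edge (u, v) (x', y') \<in> paths (X \<box> Y) (u, v) (x', y')"
    by (rule path_edge_in_paths[OF B _ _ w]) (simp_all add: V verts_box)
  let ?c = "path_class (X \<box> Y) (x, y) (x', y')"
  have Rub: "path_box_right u b \<in> paths (X \<box> Y) (u, y) (u, v)"
    by (rule path_box_right_in_paths[OF X Y b V(1)])
  have "?c r = ?c ((path_box_left a y \<star> path_box_right u b) \<star> path_edge (u, v) (x', y'))"
    unfolding r a_def b_def
    by (rule path_class_concat_cong[OF B d
          path_box_in_paths[OF X Y path_map_fst_in_paths[OF X Y d] path_map_snd_in_paths[OF X Y d]]
          Suc(1)[OF n[symmetric] d, symmetric] E E refl])
  also have "\<dots> = ?c (path_box_left a y \<star> path_box_right u b \<star> path_edge (u, v) (x', y'))"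
    unfolding path_concat_assoc[OF B La Rub E] ..
  also have "\<dots> = ?c (path_box_left (a \<star> path_edge u x') y \<star> path_box_right x' (b \<star> path_edge v y'))"
  proof -
    \<comment> \<open>A stationary last step is counted as an X-step, so the second case is a
      genuine Y-edge.\<close>
    consider "v = y'" "u = x' \<or> adj X u x'" | "u = x'" "adj Y v y'"
      using w by (auto simp: adj_box)
    then show ?thesis
    proof cases
      case 1
      note e = path_edge_in_paths[OF X V(1,3) 1(2)]
      note Le = path_box_left_in_paths[OF X Y e y]
      have Rb: "path_box_right x' b \<in> paths (X \<box> Y) (x', y) (x', v)"
        by (rule path_box_right_in_paths[OF X Y b V(3)])
      have "?c (path_box_left a y \<star> path_box_right u b \<star> path_edge (u, v) (x', y')) =
          ?c (path_box_left a y \<star> path_box_left (path_edge u x') y \<star> path_box_right x' b)"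
        using E unfolding 1(1)[symmetric] path_box_left_edge[symmetric]
        by (intro path_class_concat_cong[OF B La La refl] path_concat_in_paths[OF B Rub]
            path_concat_in_paths[OF B Le Rb]
            path_class_edge_interchange[OF X Y V(1,3) 1(2) b, symmetric])
      \<comment> \<open>The stall at the end is the image of the X-step in the Y-projection of
        \<open>r\<close>.\<close>
      also have "\<dots> = ?c ((path_box_left a y \<star> path_box_left (path_edge u x') y \<star>
          path_box_right x' b) \<star> path_stall 1 (x', v))"
        unfolding 1(1)[symmetric]
        by (rule path_class_concat_stall[OF B path_concat_in_paths[OF B La
              path_concat_in_paths[OF B Le Rb]], symmetric])
      also have "(path_box_left a y \<star> path_box_left (path_edge u x') y \<star>
          path_box_right x' b) \<star> path_stall 1 (x', v) =
          path_box_left (a \<star> path_edge u x') y \<star> path_box_right x' (b \<star> path_edge v y')"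
      proof -
        have S: "path_stall 1 (x', v) \<in> paths (X \<box> Y) (x', v) (x', v)"
          by (rule path_stall_in_paths[OF B]) (simp add: V verts_box)
        show ?thesis
          unfolding 1(1)[symmetric] path_edge_same path_box_right_concat path_box_right_stall
            path_box_left_concat path_concat_assoc[OF B La Le Rb, symmetric]
          by (rule path_concat_assoc[OF B path_concat_in_paths[OF B La Le] Rb S])
      qed
      finally show ?thesis .
    next
      case 2
      \<comment> \<open>The Y-step leaves a stall at the end of the X-projection of
        \<open>r\<close>, hence in the middle of the sorted path.\<close>
      have S: "path_stall 1 (u, y) \<in> paths (X \<box> Y) (u, y) (u, y)"
        by (rule path_stall_in_paths[OF B]) (simp add: V y verts_box)
      have R: "path_box_right u b \<star> path_edge (u, v) (u, y') \<in> paths (X \<box> Y) (u, y) (u, y')"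
        using path_concat_in_paths[OF B Rub E] 2(1) by simp
      show ?thesis
        unfolding 2(1)[symmetric] path_edge_same path_box_left_concat path_box_left_stall
          path_box_right_concat path_box_right_edge
        by (rule path_class_concat_cong[OF B La path_concat_in_paths[OF B La S]
              path_class_concat_stall[OF B La, symmetric] R R refl])
    qed
  qed
  finally show ?case unfolding rab by simp
qed

section \<open>Functors of groupoids\<close>

lemma is_functor_pair:
  assumes "is_functor G H F" "is_functor G K F'"
  shows "is_functor G (H \<times>\<^sub>G K) (functor_pair F F')"
  using assms by (simp add: is_functor_def functor_pair_def gpd_prod_def)

text \<open>Applying \<open>K\<close> after \<open>F\<close> recovers every arrow of
  \<open>G\<close>, so a proposed value of \<open>K\<close> on an arrow is confirmed by computing
  its image under \<open>F\<close>. That \<open>G\<close> is a groupoid puts the proposed identities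
  and composites into the right hom-sets.\<close>

lemma is_functor_inverse:
  assumes G: "groupoid G" and F: "is_functor G H F"
    and obj: "\<And>y. y \<in> Ob H \<Longrightarrow> fobj K y \<in> Ob G"
    and arr: "\<And>y y' g. y \<in> Ob H \<Longrightarrow> y' \<in> Ob H \<Longrightarrow> g \<in> Hom H y y' \<Longrightarrow>
      farr K y y' g \<in> Hom G (fobj K y) (fobj K y')"
    and KF: "functor_eq G (K \<circ>\<^sub>F F) functor_id" and FK: "functor_eq H (F \<circ>\<^sub>F K) functor_id"
  shows "is_functor H G K"
proof -
  have FKo: "fobj F (fobj K y) = y" if "y \<in> Ob H" for y
    using FK that by (simp add: functor_eq_def functor_comp_def functor_id_def)
  have FKa: "farr F (fobj K y) (fobj K y') (farr K y y' g) = g"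
    if "y \<in> Ob H" "y' \<in> Ob H" "g \<in> Hom H y y'" for y y' g
    using FK that by (simp add: functor_eq_def functor_comp_def functor_id_def)
  have KFa: "farr K (fobj F x) (fobj F x') (farr F x x' f) = f"
    if "x \<in> Ob G" "x' \<in> Ob G" "f \<in> Hom G x x'" for x x' f
    using KF that by (simp add: functor_eq_def functor_comp_def functor_id_def)
  have "farr K y y (Ident H y) = Ident G (fobj K y)" if y: "y \<in> Ob H" for y
  proof -
    have "Ident G (fobj K y) \<in> Hom G (fobj K y) (fobj K y)"
      using G obj[OF y] by (simp add: groupoid_def)
    moreover have "farr F (fobj K y) (fobj K y) (Ident G (fobj K y)) = Ident H y"
      using F obj[OF y] FKo[OF y] by (simp add: is_functor_def)
    ultimately show ?thesis
      using KFa[OF obj[OF y] obj[OF y]] FKo[OF y] by metis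
  qed
  moreover have "farr K x z (Comp H x y z g f) =
      Comp G (fobj K x) (fobj K y) (fobj K z) (farr K y z g) (farr K x y f)"
    if x: "x \<in> Ob H" and y: "y \<in> Ob H" and z: "z \<in> Ob H"
      and f: "f \<in> Hom H x y" and g: "g \<in> Hom H y z" for x y z f g
  proof -
    \<comment> \<open>\<open>F\<close> sends this candidate to the composite of \<open>f\<close> and
      \<open>g\<close>, because \<open>F\<close> respects composition and undoes \<open>K\<close>;
      applying \<open>K\<close> returns the candidate.\<close>
    let ?c = "Comp G (fobj K x) (fobj K y) (fobj K z) (farr K y z g) (farr K x y f)"
    have "?c \<in> Hom G (fobj K x) (fobj K z)"
      using G obj[OF x] obj[OF y] obj[OF z] arr[OF x y f] arr[OF y z g] unfolding groupoid_def
      by blast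
    moreover have "farr F (fobj K x) (fobj K z) ?c = Comp H x y z g f"
      using F obj[OF x] obj[OF y] obj[OF z] arr[OF x y f] arr[OF y z g]
        FKo[OF x] FKo[OF y] FKo[OF z] FKa[OF x y f] FKa[OF y z g]
      by (simp add: is_functor_def)
    ultimately show ?thesis
      using KFa[OF obj[OF x] obj[OF z]] FKo[OF x] FKo[OF z] by metis
  qed
  ultimately show ?thesis using obj arr by (simp add: is_functor_def)
qed

section \<open>The monoidal structure\<close>

lemma graph_map_box_fst:
  assumes "simple_graph X" "simple_graph Y"
  shows "graph_map (X \<box> Y) X (box_fst X Y)"
proof -
  have "box_fst X Y a = box_fst X Y b \<or> adj X (box_fst X Y a) (box_fst X Y b)"
    if ab: "adj (X \<box> Y) a b" for a b
    using ab simple_graphD(1,2)[OF simple_graph_box[OF assms] ab]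
    by (cases a; cases b) (auto simp: box_fst_def adj_box)
  then show ?thesis
    by (auto simp: graph_map_def box_fst_def verts_box)
qed

lemma graph_map_box_snd:
  assumes "simple_graph X" "simple_graph Y"
  shows "graph_map (X \<box> Y) Y (box_snd X Y)"
proof -
  have "box_snd X Y a = box_snd X Y b \<or> adj Y (box_snd X Y a) (box_snd X Y b)"
    if ab: "adj (X \<box> Y) a b" for a b
    using ab simple_graphD(1,2)[OF simple_graph_box[OF assms] ab]
    by (cases a; cases b) (auto simp: box_snd_def adj_box)
  then show ?thesis
    by (auto simp: graph_map_def box_snd_def verts_box)
qed

lemma fobj_Psi: "v \<in> verts (X \<box> Y) \<Longrightarrow> fobj (Psi X Y) v = v"
  by (simp add: Psi_def functor_pair_def fobj_Pi1_map box_fst_def box_snd_def)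

lemma fobj_Phi: "fobj (Phi X Y) v = v"
  by (simp add: Phi_def)

lemma farr_Psi:
  assumes X: "simple_graph X" and Y: "simple_graph Y"
    and p: "p \<in> paths (X \<box> Y) (x, y) (x', y')"
  shows "farr (Psi X Y) (x, y) (x', y') (path_class (X \<box> Y) (x, y) (x', y') p) =
    (path_class X x x' (path_map fst p), path_class Y y y' (path_map snd p))"
proof -
  note B = simple_graph_box[OF X Y]
  have "path_map (box_fst X Y) p = path_map fst p" "path_map (box_snd X Y) p = path_map snd p"
    by (rule path_map_cong[OF B p], simp add: box_fst_def box_snd_def)+
  moreover have "box_fst X Y (x, y) = x" "box_fst X Y (x', y') = x'"
    "box_snd X Y (x, y) = y" "box_snd X Y (x', y') = y'"
    using paths_endpoints[OF B p] by (simp_all add: box_fst_def box_snd_def)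
  ultimately show ?thesis
    by (simp add: Psi_def functor_pair_def farr_Pi1_map[OF B X graph_map_box_fst[OF X Y] p]
        farr_Pi1_map[OF B Y graph_map_box_snd[OF X Y] p])
qed

lemma Ob_gpd_prod: "Ob (G \<times>\<^sub>G H) = Ob G \<times> Ob H"
  by (simp add: gpd_prod_def)

lemma Hom_gpd_prod: "Hom (G \<times>\<^sub>G H) (x, y) (x', y') = Hom G x x' \<times> Hom H y y'"
  by (simp add: gpd_prod_def)

lemma Hom_Pi1_prodE:
  assumes "a \<in> Hom (Pi1 X \<times>\<^sub>G Pi1 Y) (x, y) (x', y')"
  obtains p q where "p \<in> paths X x x'" "q \<in> paths Y y y'"
    "a = (path_class X x x' p, path_class Y y y' q)"
  using assms unfolding Hom_gpd_prod by (auto elim!: Hom_Pi1E)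

lemma inverse_functors_Psi_Phi:
  assumes X: "simple_graph X" and Y: "simple_graph Y"
  shows "inverse_functors (Pi1 (X \<box> Y)) (Pi1 X \<times>\<^sub>G Pi1 Y) (Psi X Y) (Phi X Y)"
proof -
  note B = simple_graph_box[OF X Y]
  have Psi: "is_functor (Pi1 (X \<box> Y)) (Pi1 X \<times>\<^sub>G Pi1 Y) (Psi X Y)"
    unfolding Psi_def
    by (intro is_functor_pair is_functor_Pi1_map[OF B X graph_map_box_fst[OF X Y]]
        is_functor_Pi1_map[OF B Y graph_map_box_snd[OF X Y]])
  have PhiPsi: "functor_eq (Pi1 (X \<box> Y)) (Phi X Y \<circ>\<^sub>F Psi X Y) functor_id"
    unfolding functor_eq_def Ob_Pi1
  proof (intro conjI ballI; (elim Hom_Pi1E)?)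
    fix v w a r assume r: "r \<in> paths (X \<box> Y) v w" and a: "a = path_class (X \<box> Y) v w r"
    obtain x y x' y' where vw: "v = (x, y)" "w = (x', y')" by (cases v, cases w)
    note r = r[unfolded vw]
    show "farr (Phi X Y \<circ>\<^sub>F Psi X Y) v w a = farr functor_id v w a"
      using paths_endpoints[OF B r]
      by (simp add: a vw functor_comp_def functor_id_def fobj_Psi farr_Psi[OF X Y r]
          farr_Phi[OF X Y path_map_fst_in_paths[OF X Y r] path_map_snd_in_paths[OF X Y r]]
          path_class_box_decomp[OF X Y r])
  qed (simp add: functor_comp_def functor_id_def fobj_Psi fobj_Phi)
  have PsiPhi: "functor_eq (Pi1 X \<times>\<^sub>G Pi1 Y) (Psi X Y \<circ>\<^sub>F Phi X Y) functor_id"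
    unfolding functor_eq_def
  proof (intro conjI ballI)
    fix v w a assume a: "a \<in> Hom (Pi1 X \<times>\<^sub>G Pi1 Y) v w"
    obtain x y x' y' where vw: "v = (x, y)" "w = (x', y')" by (cases v, cases w)
    from a[unfolded vw] obtain p q where p: "p \<in> paths X x x'" and q: "q \<in> paths Y y y'"
      and a: "a = (path_class X x x' p, path_class Y y y' q)" by (rule Hom_Pi1_prodE)
    \<comment> \<open>Along the Y-part the X-coordinate rests at \<open>x'\<close>, so the
      projection is \<open>p\<close> followed by a stall; in Y the stall at \<open>y\<close> comes
      before \<open>q\<close>.\<close>
    have "path_class X x x' (path_map fst (path_box_left p y \<star> path_box_right x' q)) =
        path_class X x x' p"
      unfolding path_map_concat path_map_fst_box_left[OF X p] path_map_fst_box_right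
      by (rule path_class_concat_stall[OF X p])
    moreover have "path_class Y y y' (path_map snd (path_box_left p y \<star> path_box_right x' q)) =
        path_class Y y y' q"
      unfolding path_map_concat path_map_snd_box_right[OF Y q] path_map_snd_box_left
      by (rule path_class_stall_concat[OF Y q])
    ultimately show "farr (Psi X Y \<circ>\<^sub>F Phi X Y) v w a = farr functor_id v w a"
      by (simp add: a vw functor_comp_def functor_id_def fobj_Phi farr_Phi[OF X Y p q]
          farr_Psi[OF X Y path_box_in_paths[OF X Y p q]])
  qed (simp add: functor_comp_def functor_id_def fobj_Psi fobj_Phi Ob_gpd_prod Ob_Pi1 verts_box)
  have "is_functor (Pi1 X \<times>\<^sub>G Pi1 Y) (Pi1 (X \<box> Y)) (Phi X Y)"
  proof (rule is_functor_inverse[OF groupoid_Pi1[OF B] Psi _ _ PhiPsi PsiPhi])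
    fix v assume "v \<in> Ob (Pi1 X \<times>\<^sub>G Pi1 Y)"
    then show "fobj (Phi X Y) v \<in> Ob (Pi1 (X \<box> Y))"
      by (simp add: fobj_Phi Ob_Pi1 Ob_gpd_prod verts_box)
  next
    fix v w a assume a: "a \<in> Hom (Pi1 X \<times>\<^sub>G Pi1 Y) v w"
    obtain x y x' y' where vw: "v = (x, y)" "w = (x', y')" by (cases v, cases w)
    from a[unfolded vw] obtain p q where p: "p \<in> paths X x x'" and q: "q \<in> paths Y y y'"
      and a: "a = (path_class X x x' p, path_class Y y y' q)" by (rule Hom_Pi1_prodE)
    show "farr (Phi X Y) v w a \<in> Hom (Pi1 (X \<box> Y)) (fobj (Phi X Y) v) (fobj (Phi X Y) w)"
      unfolding a vw farr_Phi[OF X Y p q] fobj_Phi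
      by (rule path_class_in_Hom[OF path_box_in_paths[OF X Y p q]])
  qed
  with Psi PhiPsi PsiPhi show ?thesis by (simp add: inverse_functors_def)
qed

section \<open>The unit graph\<close>

lemma paths_interval_0:
  assumes "p \<in> paths (interval 0) x y"
  shows "x = 0" "y = 0" "p = path_stall (fst p) 0"
proof -
  note I = simple_graph_interval[of 0]
  show "x = 0" "y = 0" using paths_endpoints[OF I assms] by simp_all
  show "p = path_stall (fst p) 0"
    by (rule path_eqI[OF I assms path_stall_in_paths[OF I]])
      (use assms in \<open>auto simp: path_stall_def paths_iff[OF I]\<close>)
qed

text \<open>Every path in the one-vertex graph is a stall, hence equivalent to the constant path.
  This makes \<open>Pi1_unit\<close> invertible.\<close>

lemma Hom_Pi1_interval_0: "Hom (Pi1 (interval 0)) 0 0 = {Ident (Pi1 (interval 0)) 0}"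
proof -
  note I = simple_graph_interval[of 0]
  have "path_class (interval 0) 0 0 p = Ident (Pi1 (interval 0)) 0"
    if "p \<in> paths (interval 0) 0 0" for p
    using path_class_stall[OF I, of 0 "fst p"] paths_interval_0(3)[OF that] by (simp add: Ident_Pi1)
  moreover have "Ident (Pi1 (interval 0)) 0 \<in> Hom (Pi1 (interval 0)) 0 0"
    unfolding Ident_Pi1 by (rule path_class_in_Hom[OF path_const_in_paths[OF I]]) simp
  ultimately show ?thesis unfolding Hom_Pi1 by blast
qed

lemma functor_iso_Pi1_unit: "functor_iso gpd_unit (Pi1 (interval 0)) Pi1_unit"
proof -
  let ?I = "Pi1 (interval 0)"
  note I = simple_graph_interval[of 0]
  have c: "path_const 0 \<in> paths (interval 0) 0 0" by (rule path_const_in_paths[OF I]) simp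
  have O: "Ob ?I = {0}" by (auto simp: Ob_Pi1)
  have "Comp ?I 0 0 0 (Ident ?I 0) (Ident ?I 0) = Ident ?I 0"
    unfolding Ident_Pi1 Comp_Pi1[OF I c c] path_const_concat[OF I c] ..
  then have "inverse_functors gpd_unit ?I Pi1_unit \<lparr>fobj = (\<lambda>_. ()), farr = (\<lambda>_ _ _. ())\<rparr>"
    by (simp add: inverse_functors_def is_functor_def functor_eq_def functor_comp_def
        functor_id_def Pi1_unit_def gpd_unit_def O Hom_Pi1_interval_0)
  then show ?thesis unfolding functor_iso_def by blast
qed

section \<open>Naturality\<close>

lemma graph_map_box_map:
  assumes X: "simple_graph X" and Y: "simple_graph Y"
    and f: "graph_map X X' f" and g: "graph_map Y Y' g"
  shows "graph_map (X \<box> Y) (X' \<box> Y') (box_map X Y f g)"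
proof -
  have "box_map X Y f g a = box_map X Y f g b \<or>
      adj (X' \<box> Y') (box_map X Y f g a) (box_map X Y f g b)" if ab: "adj (X \<box> Y) a b" for a b
  proof -
    obtain x y x' y' where e: "a = (x, y)" "b = (x', y')" by (cases a, cases b)
    have v: "x \<in> verts X" "y \<in> verts Y" "x' \<in> verts X" "y' \<in> verts Y"
      using simple_graphD(1,2)[OF simple_graph_box[OF X Y] ab] by (simp_all add: e verts_box)
    have "f x = f x' \<or> adj X' (f x) (f x')" if "adj X x x'"
      using f that unfolding graph_map_def by blast
    moreover have "g y = g y' \<or> adj Y' (g y) (g y')" if "adj Y y y'"
      using g that unfolding graph_map_def by blast
    ultimately show ?thesis
      using ab v graph_map_verts[OF f] graph_map_verts[OF g]
      by (auto simp: e box_map_def verts_box adj_box)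
  qed
  then show ?thesis
    using f g by (auto simp: graph_map_def box_map_def verts_box)
qed

text \<open>A box map acts coordinatewise, so it carries the X-part at height \<open>y\<close> to
  the X-part at height \<open>g y\<close>, and the Y-part over \<open>x'\<close> to the Y-part over
  \<open>f x'\<close>.\<close>

lemma Phi_natural:
  assumes X: "simple_graph X" and X': "simple_graph X'" and Y: "simple_graph Y"
    and Y': "simple_graph Y'" and f: "graph_map X X' f" and g: "graph_map Y Y' g"
  shows "functor_eq (Pi1 X \<times>\<^sub>G Pi1 Y)
    (Pi1_map (X' \<box> Y') (box_map X Y f g) \<circ>\<^sub>F Phi X Y)
    (Phi X' Y' \<circ>\<^sub>F (Pi1_map X' f \<times>\<^sub>F Pi1_map Y' g))"
  unfolding functor_eq_def
proof (intro conjI ballI)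
  fix v w a assume a: "a \<in> Hom (Pi1 X \<times>\<^sub>G Pi1 Y) v w"
  obtain x y x' y' where vw: "v = (x, y)" "w = (x', y')" by (cases v, cases w)
  from a[unfolded vw] obtain p q where p: "p \<in> paths X x x'" and q: "q \<in> paths Y y y'"
    and a: "a = (path_class X x x' p, path_class Y y y' q)" by (rule Hom_Pi1_prodE)
  note B = simple_graph_box[OF X Y] and B' = simple_graph_box[OF X' Y']
  note V = paths_endpoints[OF X p] paths_endpoints[OF Y q]
  have m: "box_map X Y f g (u, v) = (f u, g v)" if "u \<in> verts X" "v \<in> verts Y" for u v
    using that by (simp add: box_map_def verts_box)
  have "path_map (box_map X Y f g) (path_box_left p y) = path_box_left (path_map f p) (g y)"
    using p V m
    by (auto simp: path_map_def path_box_left_def graph_comp_def compose_def paths_iff[OF X])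
  moreover have "path_map (box_map X Y f g) (path_box_right x' q) =
      path_box_right (f x') (path_map g q)"
    using q V m
    by (auto simp: path_map_def path_box_right_def graph_comp_def compose_def paths_iff[OF Y])
  ultimately show "farr (Pi1_map (X' \<box> Y') (box_map X Y f g) \<circ>\<^sub>F Phi X Y) v w a =
      farr (Phi X' Y' \<circ>\<^sub>F (Pi1_map X' f \<times>\<^sub>F Pi1_map Y' g)) v w a"
    using V
    by (simp add: a vw functor_comp_def functor_prod_def fobj_Phi fobj_Pi1_map m
        farr_Phi[OF X Y p q] farr_Pi1_map[OF X X' f p] farr_Pi1_map[OF Y Y' g q]
        farr_Pi1_map[OF B B' graph_map_box_map[OF X Y f g] path_box_in_paths[OF X Y p q]]
        farr_Phi[OF X' Y' path_map_in_paths[OF X X' f p] path_map_in_paths[OF Y Y' g q]]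
        path_map_concat)
qed (auto simp: functor_comp_def functor_prod_def fobj_Phi fobj_Pi1_map Ob_gpd_prod Ob_Pi1
    box_map_def verts_box)

section \<open>Associativity coherence\<close>

lemma graph_map_box_assoc:
  assumes "simple_graph X" "simple_graph Y" "simple_graph Z"
  shows "graph_map ((X \<box> Y) \<box> Z) (X \<box> Y \<box> Z) (box_assoc X Y Z)"
proof -
  have "adj (X \<box> Y \<box> Z) (box_assoc X Y Z a) (box_assoc X Y Z b)"
    if ab: "adj ((X \<box> Y) \<box> Z) a b" for a b
  proof -
    obtain x y z x' y' z' where e: "a = ((x, y), z)" "b = ((x', y'), z')" by (metis surj_pair)
    have "a \<in> verts ((X \<box> Y) \<box> Z)" "b \<in> verts ((X \<box> Y) \<box> Z)"
      using simple_graphD[OF simple_graph_box[OF simple_graph_box[OF assms(1,2)] assms(3)] ab] by auto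
    then show ?thesis
      using ab unfolding e by (simp add: box_assoc_def verts_box adj_box) blast
  qed
  then show ?thesis
    by (auto simp: graph_map_def box_assoc_def verts_box)
qed

text \<open>Both composites walk along \<open>p\<close>, then \<open>q\<close>, then
  \<open>r\<close>, and differ only in the bracketing of three pieces; the associator matches the
  pieces one by one, and strict associativity of concatenation does the rest.\<close>

lemma Phi_assoc:
  assumes X: "simple_graph X" and Y: "simple_graph Y" and Z: "simple_graph Z"
  shows "functor_eq ((Pi1 X \<times>\<^sub>G Pi1 Y) \<times>\<^sub>G Pi1 Z)
    (Pi1_map (X \<box> Y \<box> Z) (box_assoc X Y Z) \<circ>\<^sub>F Phi (X \<box> Y) Z \<circ>\<^sub>F (Phi X Y \<times>\<^sub>F functor_id))
    (Phi X (Y \<box> Z) \<circ>\<^sub>F (functor_id \<times>\<^sub>F Phi Y Z) \<circ>\<^sub>F gpd_assoc)"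
  unfolding functor_eq_def
proof (intro conjI ballI)
  fix s t a assume a: "a \<in> Hom ((Pi1 X \<times>\<^sub>G Pi1 Y) \<times>\<^sub>G Pi1 Z) s t"
  obtain x y z x' y' z' where st: "s = ((x, y), z)" "t = ((x', y'), z')"
    by (metis surj_pair)
  from a obtain b c where bc: "a = (b, c)" and b: "b \<in> Hom (Pi1 X \<times>\<^sub>G Pi1 Y) (x, y) (x', y')"
    and c: "c \<in> Hom (Pi1 Z) z z'"
    unfolding st Hom_gpd_prod[of "Pi1 X \<times>\<^sub>G Pi1 Y"] by blast
  from b obtain p q where p: "p \<in> paths X x x'" and q: "q \<in> paths Y y y'"
    and b: "b = (path_class X x x' p, path_class Y y y' q)" by (rule Hom_Pi1_prodE)
  from c obtain r where r: "r \<in> paths Z z z'" and c: "c = path_class Z z z' r" by (rule Hom_Pi1E)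
  note XY = simple_graph_box[OF X Y] and YZ = simple_graph_box[OF Y Z]
  note XYZ = simple_graph_box[OF XY Z] and XYZ' = simple_graph_box[OF X YZ]
  note V = paths_endpoints[OF X p] paths_endpoints[OF Y q] paths_endpoints[OF Z r]
  note pq = path_box_in_paths[OF X Y p q] and qr = path_box_in_paths[OF Y Z q r]
  let ?m = "box_assoc X Y Z"
  have m: "?m ((u, v), w) = (u, v, w)" if "u \<in> verts X" "v \<in> verts Y" "w \<in> verts Z" for u v w
    using that by (simp add: box_assoc_def verts_box)
  have P: "path_map ?m (path_box_left (path_box_left p y) z) = path_box_left p (y, z)"
    using p V m
    by (auto simp: path_map_def path_box_left_def graph_comp_def compose_def paths_iff[OF X])
  have Q: "path_map ?m (path_box_left (path_box_right x' q) z) =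
      path_box_right x' (path_box_left q z)"
    using q V m
    by (auto simp: path_map_def path_box_left_def path_box_right_def graph_comp_def compose_def
        paths_iff[OF Y])
  have R: "path_map ?m (path_box_right (x', y') r) = path_box_right x' (path_box_right y' r)"
    using r V m
    by (auto simp: path_map_def path_box_right_def graph_comp_def compose_def paths_iff[OF Z])
  have "path_map ?m (path_box_left (path_box_left p y \<star> path_box_right x' q) z \<star>
        path_box_right (x', y') r) =
      path_box_left p (y, z) \<star> path_box_right x' (path_box_left q z \<star> path_box_right y' r)"
    unfolding path_box_left_concat path_box_right_concat path_map_concat P Q R
    by (rule path_concat_assoc[OF XYZ'
          path_box_left_in_paths[OF X YZ p]
          path_box_right_in_paths[OF X YZ path_box_left_in_paths[OF Y Z q]]
          path_box_right_in_paths[OF X YZ path_box_right_in_paths[OF Y Z r]]])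
      (simp_all add: V verts_box)
  then show "farr (Pi1_map (X \<box> Y \<box> Z) ?m \<circ>\<^sub>F Phi (X \<box> Y) Z \<circ>\<^sub>F (Phi X Y \<times>\<^sub>F functor_id)) s t a =
      farr (Phi X (Y \<box> Z) \<circ>\<^sub>F (functor_id \<times>\<^sub>F Phi Y Z) \<circ>\<^sub>F gpd_assoc) s t a"
    using V
    by (simp add: st bc b c functor_comp_def functor_prod_def functor_id_def gpd_assoc_def
        fobj_Phi fobj_Pi1_map m farr_Phi[OF X Y p q] farr_Phi[OF Y Z q r]
        farr_Phi[OF XY Z pq r] farr_Phi[OF X YZ p qr]
        farr_Pi1_map[OF XYZ XYZ' graph_map_box_assoc[OF X Y Z] path_box_in_paths[OF XY Z pq r]])
next
  fix s assume s: "s \<in> Ob ((Pi1 X \<times>\<^sub>G Pi1 Y) \<times>\<^sub>G Pi1 Z)"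
  obtain x y z where "s = ((x, y), z)" by (metis surj_pair)
  with s show "fobj (Pi1_map (X \<box> Y \<box> Z) (box_assoc X Y Z) \<circ>\<^sub>F Phi (X \<box> Y) Z \<circ>\<^sub>F
        (Phi X Y \<times>\<^sub>F functor_id)) s =
      fobj (Phi X (Y \<box> Z) \<circ>\<^sub>F (functor_id \<times>\<^sub>F Phi Y Z) \<circ>\<^sub>F gpd_assoc) s"
    by (simp add: functor_comp_def functor_prod_def functor_id_def gpd_assoc_def fobj_Phi
        fobj_Pi1_map Ob_gpd_prod Ob_Pi1 box_assoc_def verts_box)
qed

section \<open>Unit coherence\<close>

lemma graph_map_box_lunit:
  assumes "simple_graph X"
  shows "graph_map (interval 0 \<box> X) X (box_lunit X)"
  using graph_map_box_snd[OF simple_graph_interval assms]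
  by (simp add: box_lunit_def box_snd_def)

lemma graph_map_box_runit:
  assumes "simple_graph X"
  shows "graph_map (X \<box> interval 0) X (box_runit X)"
  using graph_map_box_fst[OF assms simple_graph_interval]
  by (simp add: box_runit_def box_fst_def)

text \<open>\<open>Pi1_unit\<close> yields the class of a path of length 0. With this representative
  the stall that precedes \<open>p\<close> has length 0 and disappears, so no homotopy is
  required.\<close>

lemma Phi_lunit:
  assumes X: "simple_graph X"
  shows "functor_eq (gpd_unit \<times>\<^sub>G Pi1 X)
    (Pi1_map X (box_lunit X) \<circ>\<^sub>F Phi (interval 0) X \<circ>\<^sub>F (Pi1_unit \<times>\<^sub>F functor_id)) gpd_lunit"
  unfolding functor_eq_def
proof (intro conjI ballI)
  fix s t a assume a: "a \<in> Hom (gpd_unit \<times>\<^sub>G Pi1 X) s t"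
  obtain x x' where st: "s = ((), x)" "t = ((), x')" by (metis surj_pair unit.exhaust)
  from a obtain b where ab: "a = ((), b)" and b: "b \<in> Hom (Pi1 X) x x'"
    unfolding st Hom_gpd_prod by auto
  from b obtain p where p: "p \<in> paths X x x'" and b: "b = path_class X x x' p" by (rule Hom_Pi1E)
  note I = simple_graph_interval[of 0]
  note IX = simple_graph_box[OF I X]
  have c: "path_const 0 \<in> paths (interval 0) 0 0" by (rule path_const_in_paths[OF I]) simp
  note V = paths_endpoints[OF X p]
  note cp = path_box_in_paths[OF I X c p]
  have "path_map (box_lunit X) (path_box_left (path_const (0 :: nat)) x \<star> path_box_right 0 p) =
      path_map snd (path_box_left (path_const (0 :: nat)) x \<star> path_box_right 0 p)"
    by (rule path_map_cong[OF IX cp]) (simp add: box_lunit_def)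
  also have "\<dots> = path_stall 0 x \<star> p"
    unfolding path_map_concat path_map_snd_box_left path_map_snd_box_right[OF X p]
    by (simp add: path_const_def)
  also have "\<dots> = p"
    using path_const_concat[OF X p] by (simp add: path_const_def path_stall_def)
  finally show "farr (Pi1_map X (box_lunit X) \<circ>\<^sub>F Phi (interval 0) X \<circ>\<^sub>F
      (Pi1_unit \<times>\<^sub>F functor_id)) s t a = farr gpd_lunit s t a"
    using V
    by (simp add: st ab b functor_comp_def functor_prod_def functor_id_def gpd_lunit_def
        Pi1_unit_def fobj_Phi fobj_Pi1_map Ident_Pi1 farr_Phi[OF I X c p]
        farr_Pi1_map[OF IX X graph_map_box_lunit[OF X] cp])
      (simp add: box_lunit_def verts_box)
qed (auto simp: functor_comp_def functor_prod_def functor_id_def gpd_lunit_def Pi1_unit_def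
    fobj_Phi fobj_Pi1_map Ob_gpd_prod Ob_Pi1 box_lunit_def verts_box)

lemma Phi_runit:
  assumes X: "simple_graph X"
  shows "functor_eq (Pi1 X \<times>\<^sub>G gpd_unit)
    (Pi1_map X (box_runit X) \<circ>\<^sub>F Phi X (interval 0) \<circ>\<^sub>F (functor_id \<times>\<^sub>F Pi1_unit)) gpd_runit"
  unfolding functor_eq_def
proof (intro conjI ballI)
  fix s t a assume a: "a \<in> Hom (Pi1 X \<times>\<^sub>G gpd_unit) s t"
  obtain x x' where st: "s = (x, ())" "t = (x', ())" by (metis surj_pair unit.exhaust)
  from a obtain b where ab: "a = (b, ())" and b: "b \<in> Hom (Pi1 X) x x'"
    unfolding st Hom_gpd_prod by auto
  from b obtain p where p: "p \<in> paths X x x'" and b: "b = path_class X x x' p" by (rule Hom_Pi1E)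
  note I = simple_graph_interval[of 0]
  note XI = simple_graph_box[OF X I]
  have c: "path_const 0 \<in> paths (interval 0) 0 0" by (rule path_const_in_paths[OF I]) simp
  note V = paths_endpoints[OF X p]
  note pc = path_box_in_paths[OF X I p c]
  have "path_map (box_runit X) (path_box_left p (0 :: nat) \<star> path_box_right x' (path_const 0)) =
      path_map fst (path_box_left p (0 :: nat) \<star> path_box_right x' (path_const 0))"
    by (rule path_map_cong[OF XI pc]) (simp add: box_runit_def)
  also have "\<dots> = p \<star> path_stall 0 x'"
    unfolding path_map_concat path_map_fst_box_right path_map_fst_box_left[OF X p]
    by (simp add: path_const_def)
  also have "\<dots> = p"
    using path_concat_const[OF X p] by (simp add: path_const_def path_stall_def)
  finally show "farr (Pi1_map X (box_runit X) \<circ>\<^sub>F Phi X (interval 0) \<circ>\<^sub>F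
      (functor_id \<times>\<^sub>F Pi1_unit)) s t a = farr gpd_runit s t a"
    using V
    by (simp add: st ab b functor_comp_def functor_prod_def functor_id_def gpd_runit_def
        Pi1_unit_def fobj_Phi fobj_Pi1_map Ident_Pi1 farr_Phi[OF X I p c]
        farr_Pi1_map[OF XI X graph_map_box_runit[OF X] pc])
      (simp add: box_runit_def verts_box)
qed (auto simp: functor_comp_def functor_prod_def functor_id_def gpd_runit_def Pi1_unit_def
    fobj_Phi fobj_Pi1_map Ob_gpd_prod Ob_Pi1 box_runit_def verts_box)

text \<open>A morphism of \<open>Pi1 (X \<box> Y)\<close> is a class of paths of pairs and not
  literally a pair of morphisms. Strictness is therefore expressed by comparison functors that are
  the identity on objects and mutually inverse, with coherence formulated for
  \<open>Phi\<close>.\<close>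

theorem theorem3p10:
  fixes X :: "'a pregraph" and X' :: "'b pregraph" and X'' :: "'c pregraph"
    and Y :: "'d pregraph" and Y' :: "'e pregraph" and Z :: "'f pregraph"
  assumes "simple_graph X" and "simple_graph X'" and "simple_graph X''"
    and "simple_graph Y" and "simple_graph Y'" and "simple_graph Z"
  shows
    \<comment> \<open>\<open>\<Pi>\<^sub>1\<close> is a functor from graphs to groupoids\<close>
    "groupoid (Pi1 X) \<and>
     (\<forall>f. graph_map X X' f \<longrightarrow> is_functor (Pi1 X) (Pi1 X') (Pi1_map X' f)) \<and>
     functor_eq (Pi1 X) (Pi1_map X (graph_id X)) functor_id \<and>
     (\<forall>f g. graph_map X X' f \<longrightarrow> graph_map X' X'' g \<longrightarrow>
        functor_eq (Pi1 X) (Pi1_map X'' (graph_comp X g f)) (Pi1_map X'' g \<circ>\<^sub>F Pi1_map X' f)) \<and>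
     \<comment> \<open>the structure functors are mutually inverse, and the identity on objects\<close>
     inverse_functors (Pi1 (X \<box> Y)) (Pi1 X \<times>\<^sub>G Pi1 Y) (Psi X Y) (Phi X Y) \<and>
     Ob (Pi1 (X \<box> Y)) = Ob (Pi1 X \<times>\<^sub>G Pi1 Y) \<and>
     (\<forall>v\<in>Ob (Pi1 (X \<box> Y)). fobj (Psi X Y) v = v \<and> fobj (Phi X Y) v = v) \<and>
     functor_iso gpd_unit (Pi1 (interval 0)) Pi1_unit \<and>
     \<comment> \<open>naturality\<close>
     (\<forall>f g. graph_map X X' f \<longrightarrow> graph_map Y Y' g \<longrightarrow>
        functor_eq (Pi1 X \<times>\<^sub>G Pi1 Y)
          (Pi1_map (X' \<box> Y') (box_map X Y f g) \<circ>\<^sub>F Phi X Y)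
          (Phi X' Y' \<circ>\<^sub>F (Pi1_map X' f \<times>\<^sub>F Pi1_map Y' g))) \<and>
     \<comment> \<open>associativity and unit coherence\<close>
     functor_eq ((Pi1 X \<times>\<^sub>G Pi1 Y) \<times>\<^sub>G Pi1 Z)
       (Pi1_map (X \<box> (Y \<box> Z)) (box_assoc X Y Z) \<circ>\<^sub>F Phi (X \<box> Y) Z \<circ>\<^sub>F (Phi X Y \<times>\<^sub>F functor_id))
       (Phi X (Y \<box> Z) \<circ>\<^sub>F (functor_id \<times>\<^sub>F Phi Y Z) \<circ>\<^sub>F gpd_assoc) \<and>
     functor_eq (gpd_unit \<times>\<^sub>G Pi1 X)
       (Pi1_map X (box_lunit X) \<circ>\<^sub>F Phi (interval 0) X \<circ>\<^sub>F (Pi1_unit \<times>\<^sub>F functor_id))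
       gpd_lunit \<and>
     functor_eq (Pi1 X \<times>\<^sub>G gpd_unit)
       (Pi1_map X (box_runit X) \<circ>\<^sub>F Phi X (interval 0) \<circ>\<^sub>F (functor_id \<times>\<^sub>F Pi1_unit))
       gpd_runit"
proof (intro conjI allI impI ballI)
  show "Ob (Pi1 (X \<box> Y)) = Ob (Pi1 X \<times>\<^sub>G Pi1 Y)"
    by (simp add: Ob_Pi1 Ob_gpd_prod verts_box)
  fix v assume "v \<in> Ob (Pi1 (X \<box> Y))"
  then show "fobj (Psi X Y) v = v" by (simp add: Ob_Pi1 fobj_Psi)
qed (intro assms groupoid_Pi1 is_functor_Pi1_map Pi1_map_id Pi1_map_comp inverse_functors_Psi_Phi
    fobj_Phi functor_iso_Pi1_unit Phi_natural Phi_assoc Phi_lunit Phi_runit; assumption)+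

end
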